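(* Let $K_1$ and $K_2$ be knots, and for a field $\mathbb{F}$ write $s_{\mathbb{F}}(K_1,K_2)=s_{\mathbb{F}}(K_1)-s_{\mathbb{F}}(K_2)$. Then for any field $\mathbb{F}$ $$|s_{\mathbb{F}}(K_1,K_2)|\leq 2\lambda^0(K_1,K_2;\mathbb{F}).$$ Moreover, $$\max\{0,\max_{\mathbb{F}}s_{\mathbb{F}}(K_1,K_2)\}+\max\{0,\max_{\mathbb{F}}s_{\mathbb{F}}(K_2,K_1)\}\leq 2\lambda^0(K_1,K_2).$$ Similarly, $$\max_{\mathbb{F}}s_{\mathbb{F}}(K_1,K_2)+\max_{\mathbb{F}}s_{\mathbb{F}}(K_2,K_1)\leq 2\lambda(K_1,K_2).$$ Here the maxima are taken over all fields $\mathbb{F}$.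
   Context: Knots are smooth knots in $S^3$. Gradings. $\mathbb{Z}[G]$ is the polynomial ring in one variable, with quantum grading $q(1)=0$, $q(G)=-2$. Complexes are bigraded; differentials raise the homological degree by $1$ and preserve the quantum degree. $q^\ell$ denotes the quantum shift $(q^\ell M)_i=M_{i-\ell}$ and $t^j$ the homological shift. The complex $\mathrm{CBN}(K)$. It is, up to chain homotopy equivalence of graded complexes of free $\mathbb{Z}[G]$-modules, the reduced Khovanov complex for the Frobenius algebra $A=\mathbb{Z}[G][X]/(X^2+GX)$. Concretely: take an oriented diagram $D$ of $K$ with $n_\pm$ positive/negative crossings and a basepoint away from the crossings. To a vertex $v$ of the cube of resolutions (Khovanov's conventions for $0$- and $1$-smoothings) assign the tensor product over $\mathbb{Z}[G]$ of one copy of $A$ for each circle without basepoint ($1$ in degree $+1$, $X$ in degree $-1$) and $A/(X)\cong\mathbb{Z}[G]$ (generator $1$ in degree $0$) for the circle with basepoint, placed in homological degree $|v|-n_-$ and shifted in quantum degree by $|v|+n_+-2n_-$. Edge maps are, up to the usual signs, induced by multiplication $m$ (merge) and by $\Delta(1)=1\otimes X+X\otimes 1+G\,1\otimes 1$, $\Delta(X)=X\otimes X$ (split). For a commutative unital ring $R$, $\mathrm{CBN}(K;R[G])=\mathrm{CBN}(K)\otimes_{\mathbb{Z}[G]}R[G]$. Rasmussen invariant. For a field $\mathbb{F}$, $\mathrm{CBN}(K;\mathbb{F}[G])$ is homotopy equivalent to $t^0q^{s}\mathbb{F}[G]$ plus summands $t^iq^\ell\mathbb{F}[G]\xrightarrow{G^k}t^{i+1}q^{2k+\ell}\mathbb{F}[G]$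 with $k\geq1$; $s_{\mathbb{F}}(K)=s\in2\mathbb{Z}$ is the Rasmussen invariant over $\mathbb{F}$. Chain maps are $R[G]$-linear, commute with differentials and preserve the homological grading; a chain map $f$ is homogeneous of quantum degree $q(f)$ if it shifts quantum degree by $q(f)$; $\simeq$ between maps is chain homotopy. Definitions. $\lambda(K_1,K_2;R)$ is the minimal integer $n\ge 0$ such that there exist homogeneous chain maps $f\colon\mathrm{CBN}(K_1;R[G])\to\mathrm{CBN}(K_2;R[G])$ and $g\colon\mathrm{CBN}(K_2;R[G])\to\mathrm{CBN}(K_1;R[G])$ with $f\circ g\simeq G^n\cdot\mathrm{id}$ and $g\circ f\simeq G^n\cdot\mathrm{id}$. $\lambda^0(K_1,K_2;R)$ is defined in the same way with the additional requirement $q(f),q(g)\le0$. ($\min\varnothing=\infty$.) For $R=\mathbb{Z}$ the ring is omitted from the notation. *)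

theory Defs
  imports "HOL-Analysis.Analysis" "HOL-Algebra.UnivPoly" "HOL-Algebra.IntRing"
begin

section \<open>Graded complexes of free \<open>R[G]\<close>-modules\<close>

text \<open>
  \<open>R[G]\<close> is \<open>UP R\<close>. A finitely generated free bigraded complex is given by a homogeneous basis with
  its homological and quantum degrees and by the matrix of the differential; homomorphisms are
  matrices as well. In every matrix \<open>M\<close>, the entry \<open>M x y\<close> is the coefficient of the basis element
  \<open>y\<close> in the image of the basis element \<open>x\<close>. Only entries indexed by basis elements matter.
\<close>

record ('b, 'r) gcomplex =
  gens :: "'b set"
  hdeg :: "'b \<Rightarrow> int"
  qdeg :: "'b \<Rightarrow> int"
  dif :: "'b \<Rightarrow> 'b \<Rightarrow> nat \<Rightarrow> 'r"

text \<open>First \<open>M\<close>, then \<open>N\<close>; \<open>B\<close> is the basis of the module in the middle.\<close>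

definition mat_then ::
  "'r ring \<Rightarrow> 'b set \<Rightarrow> ('a \<Rightarrow> 'b \<Rightarrow> nat \<Rightarrow> 'r) \<Rightarrow> ('b \<Rightarrow> 'c \<Rightarrow> nat \<Rightarrow> 'r) \<Rightarrow> 'a \<Rightarrow> 'c \<Rightarrow> nat \<Rightarrow> 'r"
  where "mat_then R B M N = (\<lambda>x z. \<Oplus>\<^bsub>UP R\<^esub>y\<in>B. M x y \<otimes>\<^bsub>UP R\<^esub> N y z)"

definition G_power_id :: "'r ring \<Rightarrow> nat \<Rightarrow> 'b \<Rightarrow> 'b \<Rightarrow> nat \<Rightarrow> 'r"
  where "G_power_id R n = (\<lambda>x y. if x = y then up_ring.monom (UP R) \<one>\<^bsub>R\<^esub> n else \<zero>\<^bsub>UP R\<^esub>)"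

definition linear_map_of_hdegree ::
  "'r ring \<Rightarrow> int \<Rightarrow> ('b, 'r) gcomplex \<Rightarrow> ('c, 'r) gcomplex \<Rightarrow> ('b \<Rightarrow> 'c \<Rightarrow> nat \<Rightarrow> 'r) \<Rightarrow> bool"
  where "linear_map_of_hdegree R e C E f \<longleftrightarrow>
    (\<forall>x\<in>gens C. \<forall>y\<in>gens E. f x y \<in> carrier (UP R) \<and>
       (f x y \<noteq> \<zero>\<^bsub>UP R\<^esub> \<longrightarrow> hdeg E y = hdeg C x + e))"

definition chain_map ::
  "'r ring \<Rightarrow> ('b, 'r) gcomplex \<Rightarrow> ('c, 'r) gcomplex \<Rightarrow> ('b \<Rightarrow> 'c \<Rightarrow> nat \<Rightarrow> 'r) \<Rightarrow> bool"
  where "chain_map R C E f \<longleftrightarrow> linear_map_of_hdegree R 0 C E f \<and>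
    (\<forall>x\<in>gens C. \<forall>y\<in>gens E. mat_then R (gens E) f (dif E) x y = mat_then R (gens C) (dif C) f x y)"

text \<open>The monomial \<open>G\<^sup>k y\<close> has quantum degree \<open>qdeg y - 2 k\<close>.\<close>

definition homogeneous ::
  "'r ring \<Rightarrow> int \<Rightarrow> ('b, 'r) gcomplex \<Rightarrow> ('c, 'r) gcomplex \<Rightarrow> ('b \<Rightarrow> 'c \<Rightarrow> nat \<Rightarrow> 'r) \<Rightarrow> bool"
  where "homogeneous R d C E f \<longleftrightarrow>
    (\<forall>x\<in>gens C. \<forall>y\<in>gens E. \<forall>k. up_ring.coeff (UP R) (f x y) k \<noteq> \<zero>\<^bsub>R\<^esub> \<longrightarrow>
       qdeg E y - 2 * int k = qdeg C x + d)"

definition chain_homotopic ::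
  "'r ring \<Rightarrow> ('b, 'r) gcomplex \<Rightarrow> ('c, 'r) gcomplex \<Rightarrow>
    ('b \<Rightarrow> 'c \<Rightarrow> nat \<Rightarrow> 'r) \<Rightarrow> ('b \<Rightarrow> 'c \<Rightarrow> nat \<Rightarrow> 'r) \<Rightarrow> bool"
  where "chain_homotopic R C E f g \<longleftrightarrow>
    (\<exists>h. linear_map_of_hdegree R (-1) C E h \<and>
      (\<forall>x\<in>gens C. \<forall>y\<in>gens E.
        f x y \<ominus>\<^bsub>UP R\<^esub> g x y =
          mat_then R (gens E) h (dif E) x y \<oplus>\<^bsub>UP R\<^esub> mat_then R (gens C) (dif C) h x y))"

definition graded_homotopy_equivalent ::
  "'r ring \<Rightarrow> ('b, 'r) gcomplex \<Rightarrow> ('c, 'r) gcomplex \<Rightarrow> bool"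
  where "graded_homotopy_equivalent R C E \<longleftrightarrow>
    (\<exists>f g. chain_map R C E f \<and> homogeneous R 0 C E f \<and>
           chain_map R E C g \<and> homogeneous R 0 E C g \<and>
           chain_homotopic R C C (mat_then R (gens E) f g) (G_power_id R 0) \<and>
           chain_homotopic R E E (mat_then R (gens C) g f) (G_power_id R 0))"

text \<open>The image of an integral polynomial under \<open>\<int>[G] \<rightarrow> R[G]\<close>, and the induced base change.\<close>

definition poly_base_change :: "'r ring \<Rightarrow> (nat \<Rightarrow> int) \<Rightarrow> nat \<Rightarrow> 'r"
  where "poly_base_change R p = (\<lambda>i. [up_ring.coeff (UP \<Z>) p i] \<cdot>\<^bsub>R\<^esub> \<one>\<^bsub>R\<^esub>)"

definition base_change :: "'r ring \<Rightarrow> ('b, int) gcomplex \<Rightarrow> ('b, 'r) gcomplex"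
  where "base_change R C =
    \<lparr>gens = gens C, hdeg = hdeg C, qdeg = qdeg C, dif = (\<lambda>x y. poly_base_change R (dif C x y))\<rparr>"

section \<open>Knots and their diagrams\<close>

text \<open>
  An oriented diagram with basepoint is recorded by the cyclic word of crossings met when running
  once along the knot, and the crossing signs. Position \<open>i\<close> of the word is a passage through the
  crossing \<open>code ! i\<close>; edge \<open>i\<close> leads from passage \<open>i\<close> to the next passage (cyclically). A diagram
  without crossings has the single edge \<open>0\<close>. The basepoint lies on edge \<open>base\<close>.
\<close>

record 'c knot_diagram =
  code :: "'c list"
  crossing_sign :: "'c \<Rightarrow> int"
  base :: nat

abbreviation crossings :: "'c knot_diagram \<Rightarrow> 'c set"
  where "crossings D \<equiv> set (code D)"

definition edges :: "'c knot_diagram \<Rightarrow> nat set"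
  where "edges D = insert 0 {..<length (code D)}"

definition smooth_knot_param :: "(real \<Rightarrow> real^4) \<Rightarrow> bool"
  where "smooth_knot_param \<gamma> \<longleftrightarrow>
    (\<exists>d :: nat \<Rightarrow> real \<Rightarrow> real^4. d 0 = \<gamma> \<and>
      (\<forall>k t. (d k has_vector_derivative d (Suc k) t) (at t)) \<and> (\<forall>t. d 1 t \<noteq> 0)) \<and>
    (\<forall>t. \<gamma> (t + 1) = \<gamma> t) \<and> inj_on \<gamma> {0..<1} \<and> range \<gamma> \<subseteq> sphere 0 1"

definition smooth_knot :: "(real^4) set \<Rightarrow> bool"
  where "smooth_knot K \<longleftrightarrow> (\<exists>\<gamma>. smooth_knot_param \<gamma> \<and> range \<gamma> = K)"

text \<open>
  Stereographic projection of the 3-sphere from \<open>(0,0,0,1)\<close>; it preserves orientation if the sphere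
  is oriented as the boundary of the 4-ball.
\<close>

definition stereographic :: "real^4 \<Rightarrow> real^3"
  where "stereographic x = (1 / (1 - x$4)) *\<^sub>R vector [x$1, x$2, x$3]"

definition plane_projection :: "real^3 \<Rightarrow> real^2"
  where "plane_projection x = vector [x$1, x$2]"

definition det2 :: "real^2 \<Rightarrow> real^2 \<Rightarrow> real"
  where "det2 u v = u$1 * v$2 - u$2 * v$1"

definition double_times :: "(real \<Rightarrow> real^2) \<Rightarrow> real set"
  where "double_times p = {t \<in> {0..<1}. \<exists>u\<in>{0..<1}. u \<noteq> t \<and> p u = p t}"

text \<open>Immersed closed plane curve whose only multiple points are finitely many transverse double points.\<close>

definition regular_projection :: "(real \<Rightarrow> real^2) \<Rightarrow> bool"
  where "regular_projection p \<longleftrightarrow>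
    (\<forall>t. vector_derivative p (at t) \<noteq> 0) \<and>
    finite (double_times p) \<and>
    (\<forall>t\<in>double_times p. \<exists>!u. u \<in> {0..<1} \<and> u \<noteq> t \<and> p u = p t) \<and>
    (\<forall>t\<in>{0..<1}. \<forall>u\<in>{0..<1}. t \<noteq> u \<and> p t = p u \<longrightarrow>
       det2 (vector_derivative p (at t)) (vector_derivative p (at u)) \<noteq> 0)"

text \<open>
  The diagram of a parametrised knot in 3-space, seen from above. Crossings are labelled by the
  double points in the plane. A crossing is positive iff (tangent of the upper strand, tangent of
  the lower strand) is a positive basis of the plane.
\<close>

definition is_projected_diagram :: "(real \<Rightarrow> real^3) \<Rightarrow> (real^2) knot_diagram \<Rightarrow> bool"
  where "is_projected_diagram \<delta> D \<longleftrightarrow> (let p = plane_projection \<circ> \<delta> in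
    regular_projection p \<and>
    code D = map p (sorted_list_of_set (double_times p)) \<and>
    (\<forall>t\<in>{0..<1}. \<forall>u\<in>{0..<1}. t \<noteq> u \<and> p t = p u \<and> \<delta> t $ 3 > \<delta> u $ 3 \<longrightarrow>
       real_of_int (crossing_sign D (p t)) =
         sgn (det2 (vector_derivative p (at t)) (vector_derivative p (at u)))) \<and>
    base D \<in> edges D)"

text \<open>
  Rotating the 3-sphere before the stereographic projection accounts both for the choice of the
  point at infinity and for the direction of projection, so that every smooth knot has such a
  diagram. (A diagram of a knot isotopic to \<open>K\<close> is in this sense a diagram of that other knot.)
\<close>

definition diagram_of :: "(real^4) set \<Rightarrow> (real^2) knot_diagram \<Rightarrow> bool"
  where "diagram_of K D \<longleftrightarrow>
    (\<exists>\<gamma> A. smooth_knot_param \<gamma> \<and> range \<gamma> = K \<and> rotation_matrix A \<and>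
       (\<forall>t. (A *v \<gamma> t) $ 4 \<noteq> 1) \<and>
       is_projected_diagram (\<lambda>t. stereographic (A *v \<gamma> t)) D)"

section \<open>The complex CBN\<close>

text \<open>
  A vertex of the cube is the set \<open>v\<close> of the 1-smoothed crossings. The oriented smoothing is the
  0-smoothing at a positive crossing and the 1-smoothing at a negative crossing. It joins the
  incoming edge of each passage to the outgoing edge of the other passage; the other smoothing joins
  the two incoming edges, and the two outgoing edges.
\<close>

definition incoming :: "'c knot_diagram \<Rightarrow> nat \<Rightarrow> nat"
  where "incoming D i = (i + length (code D) - 1) mod length (code D)"

definition joined :: "'c knot_diagram \<Rightarrow> 'c set \<Rightarrow> (nat \<times> nat) set"
  where "joined D v = {(e, e').
    \<exists>i<length (code D). \<exists>j<length (code D). i \<noteq> j \<and> code D ! i = code D ! j \<and>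
      (if code D ! i \<in> v \<longleftrightarrow> crossing_sign D (code D ! i) = -1
       then e = incoming D i \<and> e' = j
       else (e = incoming D i \<and> e' = incoming D j) \<or> (e = i \<and> e' = j))}"

definition circles :: "'c knot_diagram \<Rightarrow> 'c set \<Rightarrow> nat set set"
  where "circles D v = edges D // (joined D v \<union> (joined D v)\<inverse>)\<^sup>*"

definition free_circles :: "'c knot_diagram \<Rightarrow> 'c set \<Rightarrow> nat set set"
  where "free_circles D v = {C \<in> circles D v. base D \<notin> C}"

text \<open>
  The basis element \<open>(v, S)\<close> of the complex is the tensor at the vertex \<open>v\<close> with factor \<open>X\<close> on the
  circles in \<open>S\<close> and \<open>1\<close> on all other circles, including the one with the basepoint.
\<close>

definition cbn_gens :: "'c knot_diagram \<Rightarrow> ('c set \<times> nat set set) set"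
  where "cbn_gens D = {(v, S). v \<subseteq> crossings D \<and> S \<subseteq> free_circles D v}"

definition n_plus :: "'c knot_diagram \<Rightarrow> int"
  where "n_plus D = int (card {c \<in> crossings D. crossing_sign D c = 1})"

definition n_minus :: "'c knot_diagram \<Rightarrow> int"
  where "n_minus D = int (card {c \<in> crossings D. crossing_sign D c = -1})"

definition cbn_hdeg :: "'c knot_diagram \<Rightarrow> 'c set \<times> nat set set \<Rightarrow> int"
  where "cbn_hdeg D = (\<lambda>(v, S). int (card v) - n_minus D)"

definition cbn_qdeg :: "'c knot_diagram \<Rightarrow> 'c set \<times> nat set set \<Rightarrow> int"
  where "cbn_qdeg D = (\<lambda>(v, S).
    (\<Sum>C\<in>free_circles D v. if C \<in> S then -1 else 1) + int (card v) + n_plus D - 2 * n_minus D)"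

text \<open>
  Structure constants of \<open>A = \<int>[G][X]/(X\<^sup>2 + G X)\<close> in the basis \<open>1, X\<close>: the coefficient in the product
  of two basis elements, \<open>k\<close> of which are \<open>X\<close>, of \<open>X\<close> (if \<open>x\<close>) or \<open>1\<close> (if not \<open>x\<close>); and the coefficient
  in \<open>\<Delta> X\<close> (if \<open>x\<close>) or \<open>\<Delta> 1\<close> (if not \<open>x\<close>) of a tensor of two basis elements, \<open>k\<close> of which are \<open>X\<close>.
\<close>

definition mult_coeff :: "nat \<Rightarrow> bool \<Rightarrow> nat \<Rightarrow> int"
  where "mult_coeff k x =
    (if k = 0 \<and> \<not> x \<or> k = 1 \<and> x then \<one>\<^bsub>UP \<Z>\<^esub>
     else if k = 2 \<and> x then up_ring.monom (UP \<Z>) (-1) 1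
     else \<zero>\<^bsub>UP \<Z>\<^esub>)"

definition comult_coeff :: "bool \<Rightarrow> nat \<Rightarrow> nat \<Rightarrow> int"
  where "comult_coeff x k =
    (if \<not> x \<and> k = 1 \<or> x \<and> k = 2 then \<one>\<^bsub>UP \<Z>\<^esub>
     else if \<not> x \<and> k = 0 then up_ring.monom (UP \<Z>) 1 1
     else \<zero>\<^bsub>UP \<Z>\<^esub>)"

text \<open>
  Matrix entry of the unsigned edge map. Passing to \<open>A/(X)\<close> on the circle with the basepoint just
  drops all tensors with \<open>X\<close> on that circle, which are not in \<open>cbn_gens\<close>.
\<close>

definition edge_map :: "'c knot_diagram \<Rightarrow> 'c set \<times> nat set set \<Rightarrow> 'c set \<times> nat set set \<Rightarrow> nat \<Rightarrow> int"
  where "edge_map D = (\<lambda>(v, S) (v', S').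
    let P = circles D v - circles D v'; Q = circles D v' - circles D v in
    if S - P \<noteq> S' - Q then \<zero>\<^bsub>UP \<Z>\<^esub>
    else if card P = 2 \<and> card Q = 1 then mult_coeff (card (S \<inter> P)) (Q \<subseteq> S')
    else if card P = 1 \<and> card Q = 2 then comult_coeff (P \<subseteq> S) (card (S' \<inter> Q))
    else \<zero>\<^bsub>UP \<Z>\<^esub>)"

text \<open>The crossings are ordered by their first occurrence in the code.\<close>

definition crossing_index :: "'c knot_diagram \<Rightarrow> 'c \<Rightarrow> nat"
  where "crossing_index D c = (LEAST i. i < length (code D) \<and> code D ! i = c)"

definition cube_sign :: "'c knot_diagram \<Rightarrow> 'c set \<Rightarrow> 'c \<Rightarrow> int"
  where "cube_sign D v c = (-1) ^ card {c' \<in> v. crossing_index D c' < crossing_index D c}"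

definition cbn_dif :: "'c knot_diagram \<Rightarrow> 'c set \<times> nat set set \<Rightarrow> 'c set \<times> nat set set \<Rightarrow> nat \<Rightarrow> int"
  where "cbn_dif D = (\<lambda>x y.
    if \<exists>c \<in> crossings D - fst x. fst y = insert c (fst x)
    then cube_sign D (fst x) (the_elem (fst y - fst x)) \<odot>\<^bsub>UP \<Z>\<^esub> edge_map D x y
    else \<zero>\<^bsub>UP \<Z>\<^esub>)"

definition CBN_integral :: "'c knot_diagram \<Rightarrow> ('c set \<times> nat set set, int) gcomplex"
  where "CBN_integral D =
    \<lparr>gens = cbn_gens D, hdeg = cbn_hdeg D, qdeg = cbn_qdeg D, dif = cbn_dif D\<rparr>"

definition CBN :: "'r ring \<Rightarrow> 'c knot_diagram \<Rightarrow> ('c set \<times> nat set set, 'r) gcomplex"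
  where "CBN R D = base_change R (CBN_integral D)"

section \<open>The Rasmussen invariant\<close>

text \<open>
  The sum of \<open>t\<^sup>0 q\<^sup>s R[G]\<close> (basis element \<open>None\<close>) and, for each entry \<open>(i, l, k)\<close> at position \<open>m\<close> of \<open>T\<close>,
  of \<open>t\<^sup>i q\<^sup>l R[G] \<rightarrow> t\<^sup>i\<^sup>+\<^sup>1 q\<^sup>2\<^sup>k\<^sup>+\<^sup>l R[G]\<close> with differential \<open>G\<^sup>k\<close> (basis elements \<open>Some (m, False)\<close>
  and \<open>Some (m, True)\<close>).
\<close>

definition standard_complex ::
  "'r ring \<Rightarrow> int \<Rightarrow> (int \<times> int \<times> nat) list \<Rightarrow> ((nat \<times> bool) option, 'r) gcomplex"
  where "standard_complex R s T =
    \<lparr>gens = insert None (Some ` ({..<length T} \<times> UNIV)),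
     hdeg = (\<lambda>x. case x of None \<Rightarrow> 0
        | Some (m, b) \<Rightarrow> (case T ! m of (i, l, k) \<Rightarrow> if b then i + 1 else i)),
     qdeg = (\<lambda>x. case x of None \<Rightarrow> s
        | Some (m, b) \<Rightarrow> (case T ! m of (i, l, k) \<Rightarrow> if b then 2 * int k + l else l)),
     dif = (\<lambda>x y. if \<exists>m<length T. x = Some (m, False) \<and> y = Some (m, True)
        then up_ring.monom (UP R) \<one>\<^bsub>R\<^esub> (snd (snd (T ! fst (the x)))) else \<zero>\<^bsub>UP R\<^esub>)\<rparr>"

text \<open>\<open>rasmussen_invariant F D s\<close>: the knot with diagram \<open>D\<close> has Rasmussen invariant \<open>s\<close> over \<open>F\<close>.\<close>

definition rasmussen_invariant :: "'r ring \<Rightarrow> 'c knot_diagram \<Rightarrow> int \<Rightarrow> bool"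
  where "rasmussen_invariant F D s \<longleftrightarrow>
    (\<exists>T. (\<forall>(i, l, k)\<in>set T. k \<ge> 1) \<and>
      graded_homotopy_equivalent F (CBN F D) (standard_complex F s T))"

section \<open>The distances \<open>\<lambda>\<close> and \<open>\<lambda>\<^sup>0\<close>\<close>

definition G_inverse_maps ::
  "'r ring \<Rightarrow> ('b, 'r) gcomplex \<Rightarrow> ('c, 'r) gcomplex \<Rightarrow> int \<Rightarrow> int \<Rightarrow> nat \<Rightarrow> bool"
  where "G_inverse_maps R C E a b n \<longleftrightarrow>
    (\<exists>f g. chain_map R C E f \<and> homogeneous R a C E f \<and>
           chain_map R E C g \<and> homogeneous R b E C g \<and>
           chain_homotopic R E E (mat_then R (gens C) g f) (G_power_id R n) \<and>
           chain_homotopic R C C (mat_then R (gens E) f g) (G_power_id R n))"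

definition lam :: "'r ring \<Rightarrow> 'c knot_diagram \<Rightarrow> 'd knot_diagram \<Rightarrow> enat"
  where "lam R D1 D2 = Inf {enat n | n. \<exists>a b. G_inverse_maps R (CBN R D1) (CBN R D2) a b n}"

definition lam0 :: "'r ring \<Rightarrow> 'c knot_diagram \<Rightarrow> 'd knot_diagram \<Rightarrow> enat"
  where "lam0 R D1 D2 =
    Inf {enat n | n. \<exists>a b. a \<le> 0 \<and> b \<le> 0 \<and> G_inverse_maps R (CBN R D1) (CBN R D2) a b n}"

text \<open>
  The maximum of a \<open>\<int>\<close>-valued function over all fields with carrier in the type \<open>'u\<close>, as a supremum of
  extended reals; theorems are polymorphic in \<open>'u\<close>.
\<close>

definition max_over_fields :: "('u ring \<Rightarrow> int) \<Rightarrow> ereal"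
  where "max_over_fields h = (SUP F\<in>{F. Ring.field F}. ereal (real_of_int (h F)))"

end

theory Submission
  imports Defs
begin

text \<open>
  Passing to chain complexes homotopy equivalent to \<open>CBN\<close>, maps that are inverse up to \<open>G\<^sup>n\<close> over a
  field become maps \<open>f\<close>, \<open>g\<close> between complexes in standard form. A component of a chain map out of
  the free summand lands in cycles and hence has no component in the source of a torsion summand,
  and a chain map into the free summand kills the targets of the torsion summands, because \<open>G\<^sup>k\<close> is
  not a zero divisor. So the homotopy relation on the free summand reads \<open>f\<^sub>0 g\<^sub>0 = G\<^sup>n\<close>: there are
  \<open>i + j = n\<close> such that \<open>G\<^sup>i\<close> occurs in \<open>f\<^sub>0\<close> and \<open>G\<^sup>j\<close> in \<open>g\<^sub>0\<close>, and comparing quantum degrees gives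
  \<open>s\<^sub>2 - s\<^sub>1 = q(f) + 2 i\<close> and \<open>s\<^sub>1 - s\<^sub>2 = q(g) + 2 j\<close>. In particular \<open>q(f) + q(g) = - 2 n\<close>. Maps
  defined over \<open>\<int>\<close> can be base changed to every field, with degrees \<open>q(f)\<close>, \<open>q(g)\<close> independent of
  the field, which bounds both maxima at once.
\<close>

section \<open>Matrices over a polynomial ring\<close>

lemma (in abelian_monoid) finsum_swap:
  assumes "finite A" "finite B" "\<And>x y. x \<in> A \<Longrightarrow> y \<in> B \<Longrightarrow> f x y \<in> carrier G"
  shows "(\<Oplus>x\<in>A. \<Oplus>y\<in>B. f x y) = (\<Oplus>y\<in>B. \<Oplus>x\<in>A. f x y)"
  using assms(1,3)
proof (induction A rule: finite_induct)
  case empty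
  then show ?case by simp
next
  case (insert a A)
  have "(\<Oplus>x\<in>insert a A. \<Oplus>y\<in>B. f x y) = (\<Oplus>y\<in>B. f a y) \<oplus> (\<Oplus>y\<in>B. \<Oplus>x\<in>A. f x y)"
    using insert by (simp add: Pi_def)
  also have "\<dots> = (\<Oplus>y\<in>B. f a y \<oplus> (\<Oplus>x\<in>A. f x y))"
    using insert.prems by (intro finsum_addf [symmetric]) auto
  also have "\<dots> = (\<Oplus>y\<in>B. \<Oplus>x\<in>insert a A. f x y)"
    using insert by (intro finsum_cong') (auto simp: Pi_def)
  finally show ?case .
qed

lemma (in abelian_monoid) finsum_eq_single:
  assumes "i \<in> A" "finite A" "f i \<in> carrier G" "\<And>j. j \<in> A \<Longrightarrow> j \<noteq> i \<Longrightarrow> f j = \<zero>"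
  shows "(\<Oplus>j\<in>A. f j) = f i"
proof -
  have "(\<Oplus>j\<in>A. f j) = (\<Oplus>j\<in>A. if i = j then f i else \<zero>)"
    using assms by (intro finsum_cong') auto
  also have "\<dots> = f i"
    using finsum_singleton [OF assms(1,2), of "\<lambda>_. f i"] assms(3) by simp
  finally show ?thesis .
qed

text \<open>A ring-independent setting for the matrix calculus, so that its lemmas are available at
  once for a ring \<open>R\<close> and, as \<open>int_UP\<close>, for \<open>\<Z>\<close>. The
  definitions spell out \<open>UP R\<close>; they are folded to \<open>P\<close> by
  \<open>P_def[symmetric]\<close>.\<close>

locale UP_matrices = UP_cring R P for R :: "'r ring" (structure) and P (structure)
begin

text \<open>Matrices are total functions whose entries off the bases are arbitrary, so membership in
  \<open>P\<close> is asked only for entries indexed by \<open>A\<close> and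
  \<open>B\<close>.\<close>

definition matrix_on :: "'b set \<Rightarrow> 'c set \<Rightarrow> ('b \<Rightarrow> 'c \<Rightarrow> nat \<Rightarrow> 'r) \<Rightarrow> bool"
  where "matrix_on A B M \<longleftrightarrow> (\<forall>x\<in>A. \<forall>y\<in>B. M x y \<in> carrier P)"

lemma matrix_onD: "matrix_on A B M \<Longrightarrow> x \<in> A \<Longrightarrow> y \<in> B \<Longrightarrow> M x y \<in> carrier P"
  by (simp add: matrix_on_def)

lemma mat_then_eq: "mat_then R B M N x z = (\<Oplus>\<^bsub>P\<^esub>y\<in>B. M x y \<otimes>\<^bsub>P\<^esub> N y z)"
  by (simp add: mat_then_def P_def)

lemma matrix_on_mat_then:
  assumes "matrix_on A B M" "matrix_on B C N"
  shows "matrix_on A C (mat_then R B M N)"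
  using assms unfolding matrix_on_def mat_then_eq by (auto intro!: P.finsum_closed)

text \<open>Identities between matrices hold on basis elements only, never as equations of
  functions; this is how they are substituted inside a product.\<close>

lemma mat_then_cong:
  assumes "matrix_on A B M" "matrix_on B C N" "x \<in> A" "z \<in> C"
    and "\<And>y. y \<in> B \<Longrightarrow> M' x y = M x y" "\<And>y. y \<in> B \<Longrightarrow> N' y z = N y z"
  shows "mat_then R B M' N' x z = mat_then R B M N x z"
  using assms unfolding matrix_on_def mat_then_eq by (intro P.finsum_cong') auto

lemma mat_then_single:
  assumes "matrix_on A B M" "matrix_on B C N" "finite B" "x \<in> A" "z \<in> C" "i \<in> B"
    and "\<And>y. y \<in> B \<Longrightarrow> y \<noteq> i \<Longrightarrow> M x y = \<zero>\<^bsub>P\<^esub> \<or> N y z = \<zero>\<^bsub>P\<^esub>"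
  shows "mat_then R B M N x z = M x i \<otimes>\<^bsub>P\<^esub> N i z"
  unfolding mat_then_eq using assms
  by (intro P.finsum_eq_single) (force simp: matrix_on_def)+

lemma mat_then_zero:
  assumes "matrix_on A B M" "matrix_on B C N" "x \<in> A" "z \<in> C"
    and "\<And>y. y \<in> B \<Longrightarrow> M x y = \<zero>\<^bsub>P\<^esub> \<or> N y z = \<zero>\<^bsub>P\<^esub>"
  shows "mat_then R B M N x z = \<zero>\<^bsub>P\<^esub>"
  unfolding mat_then_eq using assms
  by (intro P.add.finprod_one_eqI) (force simp: matrix_on_def)

lemma mat_then_assoc:
  assumes "matrix_on A B M" "matrix_on B C N" "matrix_on C E L" "finite B" "finite C"
    and "x \<in> A" "z \<in> E"
  shows "mat_then R C (mat_then R B M N) L x z = mat_then R B M (mat_then R C N L) x z"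
proof -
  note [simp] = matrix_onD [OF assms(1)] matrix_onD [OF assms(2)] matrix_onD [OF assms(3)]
  have "mat_then R C (mat_then R B M N) L x z =
      (\<Oplus>\<^bsub>P\<^esub>w\<in>C. \<Oplus>\<^bsub>P\<^esub>y\<in>B. M x y \<otimes>\<^bsub>P\<^esub> N y w \<otimes>\<^bsub>P\<^esub> L w z)"
    unfolding mat_then_eq using assms(4-)
    by (intro P.finsum_cong' refl P.finsum_ldistr) (auto simp: Pi_def)
  also have "\<dots> = (\<Oplus>\<^bsub>P\<^esub>y\<in>B. \<Oplus>\<^bsub>P\<^esub>w\<in>C. M x y \<otimes>\<^bsub>P\<^esub> N y w \<otimes>\<^bsub>P\<^esub> L w z)"
    using assms(4-) by (intro P.finsum_swap) auto
  also have "\<dots> = (\<Oplus>\<^bsub>P\<^esub>y\<in>B. \<Oplus>\<^bsub>P\<^esub>w\<in>C. M x y \<otimes>\<^bsub>P\<^esub> (N y w \<otimes>\<^bsub>P\<^esub> L w z))"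
    using assms(4-) by (intro P.finsum_cong' refl) (auto simp: P.m_assoc Pi_def)
  also have "\<dots> = mat_then R B M (mat_then R C N L) x z"
    unfolding mat_then_eq using assms(4-)
    by (intro P.finsum_cong' refl P.finsum_rdistr [symmetric]) (auto simp: Pi_def)
  finally show ?thesis .
qed

lemma mat_then_add_left:
  assumes "matrix_on A B M" "matrix_on A B M'" "matrix_on B C N" "x \<in> A" "z \<in> C"
  shows "mat_then R B (\<lambda>x y. M x y \<oplus>\<^bsub>P\<^esub> M' x y) N x z =
    mat_then R B M N x z \<oplus>\<^bsub>P\<^esub> mat_then R B M' N x z"
proof -
  note [simp] = matrix_onD [OF assms(1)] matrix_onD [OF assms(2)] matrix_onD [OF assms(3)]
  have "mat_then R B (\<lambda>x y. M x y \<oplus>\<^bsub>P\<^esub> M' x y) N x z =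
      (\<Oplus>\<^bsub>P\<^esub>y\<in>B. M x y \<otimes>\<^bsub>P\<^esub> N y z \<oplus>\<^bsub>P\<^esub> M' x y \<otimes>\<^bsub>P\<^esub> N y z)"
    unfolding mat_then_eq using assms(4-)
    by (intro P.finsum_cong' refl P.l_distr) (auto simp: Pi_def)
  also have "\<dots> = mat_then R B M N x z \<oplus>\<^bsub>P\<^esub> mat_then R B M' N x z"
    unfolding mat_then_eq using assms(4-) by (intro P.finsum_addf) auto
  finally show ?thesis .
qed

lemma mat_then_add_right:
  assumes "matrix_on A B M" "matrix_on B C N" "matrix_on B C N'" "x \<in> A" "z \<in> C"
  shows "mat_then R B M (\<lambda>x y. N x y \<oplus>\<^bsub>P\<^esub> N' x y) x z =
    mat_then R B M N x z \<oplus>\<^bsub>P\<^esub> mat_then R B M N' x z"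
proof -
  note [simp] = matrix_onD [OF assms(1)] matrix_onD [OF assms(2)] matrix_onD [OF assms(3)]
  have "mat_then R B M (\<lambda>x y. N x y \<oplus>\<^bsub>P\<^esub> N' x y) x z =
      (\<Oplus>\<^bsub>P\<^esub>y\<in>B. M x y \<otimes>\<^bsub>P\<^esub> N y z \<oplus>\<^bsub>P\<^esub> M x y \<otimes>\<^bsub>P\<^esub> N' y z)"
    unfolding mat_then_eq using assms(4-)
    by (intro P.finsum_cong' refl P.r_distr) (auto simp: Pi_def)
  also have "\<dots> = mat_then R B M N x z \<oplus>\<^bsub>P\<^esub> mat_then R B M N' x z"
    unfolding mat_then_eq using assms(4-) by (intro P.finsum_addf) auto
  finally show ?thesis .
qed

text \<open>Here and in \<open>mat_then_G_power_id_left\<close> the scalar ends up in front.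
  Comparing the two shows that multiplication by \<open>G\<^sup>n\<close> commutes with every
  matrix.\<close>

lemma mat_then_G_power_id_right:
  assumes "matrix_on A B M" "finite B" "x \<in> A" "z \<in> B"
  shows "mat_then R B M (G_power_id R n) x z = monom P \<one> n \<otimes>\<^bsub>P\<^esub> M x z"
proof -
  have "mat_then R B M (G_power_id R n) x z = M x z \<otimes>\<^bsub>P\<^esub> G_power_id R n z z"
    using assms by (intro mat_then_single [where A = A and C = B])
      (auto simp: G_power_id_def matrix_on_def P_def[symmetric])
  then show ?thesis
    using matrix_onD [OF assms(1,3,4)] by (simp add: G_power_id_def P.m_comm P_def[symmetric])
qed

lemma mat_then_G_power_id_left:
  assumes "matrix_on A B M" "finite A" "x \<in> A" "z \<in> B"
  shows "mat_then R A (G_power_id R n) M x z = monom P \<one> n \<otimes>\<^bsub>P\<^esub> M x z"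
proof -
  have "mat_then R A (G_power_id R n) M x z = G_power_id R n x x \<otimes>\<^bsub>P\<^esub> M x z"
    using assms by (intro mat_then_single [where A = A and C = B])
      (auto simp: G_power_id_def matrix_on_def P_def[symmetric])
  then show ?thesis
    by (simp add: G_power_id_def P_def[symmetric])
qed


text \<open>The coefficient is a convolution sum, which vanishes if every summand has a zero factor.
  This locates the monomials whose quantum degrees get compared.\<close>

lemma coeff_mult_nonzeroE:
  assumes "p \<in> carrier P" "q \<in> carrier P" "coeff P (p \<otimes>\<^bsub>P\<^esub> q) n \<noteq> \<zero>"
  obtains i j where "i + j = n" "coeff P p i \<noteq> \<zero>" "coeff P q j \<noteq> \<zero>"
proof -
  have "\<exists>i\<le>n. coeff P p i \<noteq> \<zero> \<and> coeff P q (n - i) \<noteq> \<zero>"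
  proof (rule ccontr)
    assume neg: "\<not> ?thesis"
    have "(\<Oplus>i\<in>{..n}. coeff P p i \<otimes> coeff P q (n - i)) = \<zero>"
    proof (rule R.add.finprod_one_eqI)
      fix i assume "i \<in> {..n}"
      with neg have "coeff P p i = \<zero> \<or> coeff P q (n - i) = \<zero>" by auto
      with assms show "coeff P p i \<otimes> coeff P q (n - i) = \<zero>" by auto
    qed
    with assms show False by simp
  qed
  then show thesis using that le_add_diff_inverse by blast
qed

section \<open>Chain maps and homotopies of finite complexes\<close>

text \<open>What the matrix calculus asks of a complex: sums over a finite basis, and a differential
  with entries in \<open>P\<close>.\<close>

definition finite_gcomplex :: "('b, 'r) gcomplex \<Rightarrow> bool"
  where "finite_gcomplex C \<longleftrightarrow> finite (gens C) \<and> matrix_on (gens C) (gens C) (dif C)"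

section \<open>Maps between finite complexes and their composites\<close>

lemma linear_map_matrix_on: "linear_map_of_hdegree R e C E f \<Longrightarrow> matrix_on (gens C) (gens E) f"
  by (simp add: linear_map_of_hdegree_def matrix_on_def P_def)

lemma chain_map_matrix_on: "chain_map R C E f \<Longrightarrow> matrix_on (gens C) (gens E) f"
  by (auto simp: chain_map_def linear_map_matrix_on)

lemma chain_map_commute:
  "chain_map R C E f \<Longrightarrow> x \<in> gens C \<Longrightarrow> y \<in> gens E \<Longrightarrow>
    mat_then R (gens E) f (dif E) x y = mat_then R (gens C) (dif C) f x y"
  by (simp add: chain_map_def)

text \<open>A nonzero entry of the product passes through some middle generator \<open>y\<close> at
  which both factors are nonzero, and the two degree shifts add.\<close>

lemma linear_map_then:
  assumes f: "linear_map_of_hdegree R e C D f" and g: "linear_map_of_hdegree R e' D E g"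
  shows "linear_map_of_hdegree R (e + e') C E (mat_then R (gens D) f g)"
  unfolding linear_map_of_hdegree_def P_def[symmetric]
proof (intro ballI conjI impI)
  fix x z assume xz: "x \<in> gens C" "z \<in> gens E"
  note mats = linear_map_matrix_on [OF f] linear_map_matrix_on [OF g]
  from matrix_on_mat_then [OF mats] xz show "mat_then R (gens D) f g x z \<in> carrier P"
    by (rule matrix_onD)
  assume "mat_then R (gens D) f g x z \<noteq> \<zero>\<^bsub>P\<^esub>"
  then obtain y where "y \<in> gens D" "f x y \<noteq> \<zero>\<^bsub>P\<^esub>" "g y z \<noteq> \<zero>\<^bsub>P\<^esub>"
    using mat_then_zero [OF mats xz] by blast
  with f g xz show "hdeg E z = hdeg C x + (e + e')"
    by (simp add: linear_map_of_hdegree_def P_def)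
qed

text \<open>A nonzero coefficient at \<open>G\<^sup>k\<close> arises from some middle generator and
  exponents \<open>i + j = k\<close> occurring in the two factors; the contributions
  \<open>- 2 i\<close> and \<open>- 2 j\<close> add up.\<close>

lemma homogeneous_then:
  assumes f: "matrix_on (gens C) (gens D) f" "homogeneous R d C D f"
    and g: "matrix_on (gens D) (gens E) g" "homogeneous R d' D E g"
    and fin: "finite (gens D)"
  shows "homogeneous R (d + d') C E (mat_then R (gens D) f g)"
  unfolding homogeneous_def P_def[symmetric]
proof (intro ballI allI impI)
  fix x z k
  assume xz: "x \<in> gens C" "z \<in> gens E" and "coeff P (mat_then R (gens D) f g x z) k \<noteq> \<zero>"
  then have "(\<Oplus>y\<in>gens D. coeff P (f x y \<otimes>\<^bsub>P\<^esub> g y z) k) \<noteq> \<zero>"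
    using f g fin by (simp add: mat_then_eq coeff_finsum Pi_def matrix_on_def del: coeff_mult)
  then obtain y where y: "y \<in> gens D" "coeff P (f x y \<otimes>\<^bsub>P\<^esub> g y z) k \<noteq> \<zero>"
    using R.add.finprod_one_eqI [of "gens D" "\<lambda>y. coeff P (f x y \<otimes>\<^bsub>P\<^esub> g y z) k"] by blast
  obtain i j where ij: "i + j = k" "coeff P (f x y) i \<noteq> \<zero>" "coeff P (g y z) j \<noteq> \<zero>"
    using coeff_mult_nonzeroE [OF matrix_onD [OF f(1) xz(1) y(1)] matrix_onD [OF g(1) y(1) xz(2)] y(2)] .
  have "qdeg D y - 2 * int i = qdeg C x + d"
    using f(2) xz(1) y(1) ij(2) unfolding homogeneous_def P_def[symmetric] by blast
  moreover have "qdeg E z - 2 * int j = qdeg D y + d'"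
    using g(2) xz(2) y(1) ij(3) unfolding homogeneous_def P_def[symmetric] by blast
  ultimately show "qdeg E z - 2 * int k = qdeg C x + (d + d')"
    using ij(1) by simp
qed

lemma chain_map_then:
  assumes f: "chain_map R C D f" and g: "chain_map R D E g"
    and fin: "finite_gcomplex C" "finite_gcomplex D" "finite_gcomplex E"
  shows "chain_map R C E (mat_then R (gens D) f g)"
  unfolding chain_map_def
proof (intro ballI conjI)
  show "linear_map_of_hdegree R 0 C E (mat_then R (gens D) f g)"
    using linear_map_then [of 0 C D f 0 E g] f g by (simp add: chain_map_def)
  fix x z assume xz: "x \<in> gens C" "z \<in> gens E"
  note mf = chain_map_matrix_on [OF f] and mg = chain_map_matrix_on [OF g]
  from fin have C: "finite (gens C)" "matrix_on (gens C) (gens C) (dif C)"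
    and D: "finite (gens D)" "matrix_on (gens D) (gens D) (dif D)"
    and E: "finite (gens E)" "matrix_on (gens E) (gens E) (dif E)"
    by (auto simp: finite_gcomplex_def)
  have "mat_then R (gens E) (mat_then R (gens D) f g) (dif E) x z =
      mat_then R (gens D) f (mat_then R (gens E) g (dif E)) x z"
    by (rule mat_then_assoc [OF mf mg E(2) D(1) E(1) xz])
  also have "\<dots> = mat_then R (gens D) f (mat_then R (gens D) (dif D) g) x z"
    by (rule mat_then_cong [OF mf matrix_on_mat_then [OF D(2) mg] xz])
      (simp_all add: chain_map_commute [OF g] xz)
  also have "\<dots> = mat_then R (gens D) (mat_then R (gens D) f (dif D)) g x z"
    by (rule mat_then_assoc [OF mf D(2) mg D(1) D(1) xz, symmetric])
  also have "\<dots> = mat_then R (gens D) (mat_then R (gens C) (dif C) f) g x z"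
    by (rule mat_then_cong [OF matrix_on_mat_then [OF C(2) mf] mg xz])
      (simp_all add: chain_map_commute [OF f] xz)
  also have "\<dots> = mat_then R (gens C) (dif C) (mat_then R (gens D) f g) x z"
    by (rule mat_then_assoc [OF C(2) mf mg C(1) D(1) xz])
  finally show "mat_then R (gens E) (mat_then R (gens D) f g) (dif E) x z =
      mat_then R (gens C) (dif C) (mat_then R (gens D) f g) x z" .
qed

text \<open>Moving \<open>g\<close> to the other side removes the subtraction, so that additivity of
  \<open>mat_then\<close> suffices for all manipulations of homotopies.\<close>

lemma chain_homotopic_iff:
  assumes "matrix_on (gens C) (gens E) f" "matrix_on (gens C) (gens E) g"
    and "finite_gcomplex C" "finite_gcomplex E"
  shows "chain_homotopic R C E f g \<longleftrightarrow>
    (\<exists>h. linear_map_of_hdegree R (-1) C E h \<and>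
      (\<forall>x\<in>gens C. \<forall>y\<in>gens E.
        f x y = (mat_then R (gens E) h (dif E) x y \<oplus>\<^bsub>P\<^esub> mat_then R (gens C) (dif C) h x y) \<oplus>\<^bsub>P\<^esub> g x y))"
proof -
  have "f x y \<ominus>\<^bsub>P\<^esub> g x y = mat_then R (gens E) h (dif E) x y \<oplus>\<^bsub>P\<^esub> mat_then R (gens C) (dif C) h x y
    \<longleftrightarrow> f x y = (mat_then R (gens E) h (dif E) x y \<oplus>\<^bsub>P\<^esub> mat_then R (gens C) (dif C) h x y) \<oplus>\<^bsub>P\<^esub> g x y"
    if h: "linear_map_of_hdegree R (-1) C E h" and xy: "x \<in> gens C" "y \<in> gens E" for h x y
  proof -
    from assms(3,4) have "matrix_on (gens C) (gens C) (dif C)" "matrix_on (gens E) (gens E) (dif E)"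
      by (auto simp: finite_gcomplex_def)
    then have "mat_then R (gens E) h (dif E) x y \<in> carrier P" "mat_then R (gens C) (dif C) h x y \<in> carrier P"
      using matrix_on_mat_then linear_map_matrix_on [OF h] xy by (blast intro: matrix_onD)+
    moreover have "f x y \<in> carrier P" "g x y \<in> carrier P"
      using assms(1,2) xy by (auto intro: matrix_onD)
    ultimately show ?thesis
      unfolding a_minus_def by (intro P.add.inv_solve_right') auto
  qed
  then show ?thesis
    unfolding chain_homotopic_def P_def[symmetric] by (intro ex_cong1 conj_cong refl ball_cong) auto
qed

lemma chain_homotopic_cong:
  assumes "chain_homotopic R C E f g"
    and "\<And>x y. x \<in> gens C \<Longrightarrow> y \<in> gens E \<Longrightarrow> f' x y = f x y"
    and "\<And>x y. x \<in> gens C \<Longrightarrow> y \<in> gens E \<Longrightarrow> g' x y = g x y"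
  shows "chain_homotopic R C E f' g'"
  using assms unfolding chain_homotopic_def by metis

text \<open>The sum of the two homotopies works, since the boundary expression is additive in the
  homotopy.\<close>

lemma chain_homotopic_trans:
  assumes "chain_homotopic R C E f g" "chain_homotopic R C E g k"
    and mats: "matrix_on (gens C) (gens E) f" "matrix_on (gens C) (gens E) g" "matrix_on (gens C) (gens E) k"
    and fin: "finite_gcomplex C" "finite_gcomplex E"
  shows "chain_homotopic R C E f k"
proof -
  let ?H = "\<lambda>h x y. mat_then R (gens E) h (dif E) x y \<oplus>\<^bsub>P\<^esub> mat_then R (gens C) (dif C) h x y"
  from assms obtain h h' where h: "linear_map_of_hdegree R (-1) C E h"
      "\<And>x y. x \<in> gens C \<Longrightarrow> y \<in> gens E \<Longrightarrow> f x y = ?H h x y \<oplus>\<^bsub>P\<^esub> g x y"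
    and h': "linear_map_of_hdegree R (-1) C E h'"
      "\<And>x y. x \<in> gens C \<Longrightarrow> y \<in> gens E \<Longrightarrow> g x y = ?H h' x y \<oplus>\<^bsub>P\<^esub> k x y"
    by (auto simp: chain_homotopic_iff)
  have "linear_map_of_hdegree R (-1) C E (\<lambda>x y. h x y \<oplus>\<^bsub>P\<^esub> h' x y)"
    unfolding linear_map_of_hdegree_def P_def[symmetric]
  proof (intro ballI conjI impI)
    fix x y assume xy: "x \<in> gens C" "y \<in> gens E"
    note mh = matrix_onD [OF linear_map_matrix_on [OF h(1)] xy]
      matrix_onD [OF linear_map_matrix_on [OF h'(1)] xy]
    then show "h x y \<oplus>\<^bsub>P\<^esub> h' x y \<in> carrier P" by simp
    assume "h x y \<oplus>\<^bsub>P\<^esub> h' x y \<noteq> \<zero>\<^bsub>P\<^esub>"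
    then have "h x y \<noteq> \<zero>\<^bsub>P\<^esub> \<or> h' x y \<noteq> \<zero>\<^bsub>P\<^esub>" by auto
    then show "hdeg E y = hdeg C x + - 1"
      using h(1) h'(1) xy unfolding linear_map_of_hdegree_def P_def[symmetric] by blast
  qed
  moreover have "f x y = ?H (\<lambda>x y. h x y \<oplus>\<^bsub>P\<^esub> h' x y) x y \<oplus>\<^bsub>P\<^esub> k x y"
    if xy: "x \<in> gens C" "y \<in> gens E" for x y
  proof -
    note mh = linear_map_matrix_on [OF h(1)] linear_map_matrix_on [OF h'(1)]
    from fin have C: "matrix_on (gens C) (gens C) (dif C)"
      and E: "matrix_on (gens E) (gens E) (dif E)" by (auto simp: finite_gcomplex_def)
    note [simp] = mat_then_add_left [OF mh E xy] mat_then_add_right [OF C mh xy]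
      matrix_onD [OF matrix_on_mat_then [OF mh(1) E] xy] matrix_onD [OF matrix_on_mat_then [OF mh(2) E] xy]
      matrix_onD [OF matrix_on_mat_then [OF C mh(1)] xy] matrix_onD [OF matrix_on_mat_then [OF C mh(2)] xy]
      matrix_onD [OF mats(3) xy]
    show ?thesis
      using h(2) [OF xy] h'(2) [OF xy] by (simp add: P.a_ac)
  qed
  ultimately show ?thesis
    using chain_homotopic_iff [OF mats(1,3) fin] by blast
qed

text \<open>If \<open>h\<close> is a homotopy from \<open>f\<close> to \<open>g\<close>, then
  \<open>p\<close> followed by \<open>h\<close> is the required one: \<open>p\<close> has degree 0
  and commutes with the differentials without a sign.\<close>

lemma chain_homotopic_then_left:
  assumes p: "chain_map R A C p" and fg: "chain_homotopic R C E f g"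
    and mats: "matrix_on (gens C) (gens E) f" "matrix_on (gens C) (gens E) g"
    and fin: "finite_gcomplex A" "finite_gcomplex C" "finite_gcomplex E"
  shows "chain_homotopic R A E (mat_then R (gens C) p f) (mat_then R (gens C) p g)"
proof -
  let ?H = "\<lambda>h x y. mat_then R (gens E) h (dif E) x y \<oplus>\<^bsub>P\<^esub> mat_then R (gens C) (dif C) h x y"
  from fg obtain h where h: "linear_map_of_hdegree R (-1) C E h"
    "\<And>x y. x \<in> gens C \<Longrightarrow> y \<in> gens E \<Longrightarrow> f x y = ?H h x y \<oplus>\<^bsub>P\<^esub> g x y"
    unfolding chain_homotopic_iff [OF mats fin(2,3)] by blast
  let ?ph = "mat_then R (gens C) p h"
  from fin have A: "finite (gens A)" "matrix_on (gens A) (gens A) (dif A)"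
    and C: "finite (gens C)" "matrix_on (gens C) (gens C) (dif C)"
    and E: "finite (gens E)" "matrix_on (gens E) (gens E) (dif E)"
    by (auto simp: finite_gcomplex_def)
  note mp = chain_map_matrix_on [OF p] and mh = linear_map_matrix_on [OF h(1)]
  have mH: "matrix_on (gens C) (gens E) (?H h)"
    using matrix_on_mat_then [OF mh E(2)] matrix_on_mat_then [OF C(2) mh]
    by (simp add: matrix_on_def)
  have "linear_map_of_hdegree R (-1) A E ?ph"
    using linear_map_then [of 0 A C p "-1" E h] p h(1) by (simp add: chain_map_def)
  moreover have "mat_then R (gens C) p f x z =
      (mat_then R (gens E) ?ph (dif E) x z \<oplus>\<^bsub>P\<^esub> mat_then R (gens A) (dif A) ?ph x z)
      \<oplus>\<^bsub>P\<^esub> mat_then R (gens C) p g x z"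
    if xz: "x \<in> gens A" "z \<in> gens E" for x z
  proof -
    have "mat_then R (gens C) p f x z = mat_then R (gens C) p (\<lambda>x y. ?H h x y \<oplus>\<^bsub>P\<^esub> g x y) x z"
      using h(2) xz mats(1) by (intro mat_then_cong [OF mp _ xz, symmetric]) (auto simp: matrix_on_def)
    also have "\<dots> = mat_then R (gens C) p (?H h) x z \<oplus>\<^bsub>P\<^esub> mat_then R (gens C) p g x z"
      by (rule mat_then_add_right [OF mp mH mats(2) xz])
    also have "mat_then R (gens C) p (?H h) x z =
        mat_then R (gens C) p (mat_then R (gens E) h (dif E)) x z \<oplus>\<^bsub>P\<^esub>
        mat_then R (gens C) p (mat_then R (gens C) (dif C) h) x z"
      by (rule mat_then_add_right [OF mp matrix_on_mat_then [OF mh E(2)] matrix_on_mat_then [OF C(2) mh] xz])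
    also have "mat_then R (gens C) p (mat_then R (gens E) h (dif E)) x z = mat_then R (gens E) ?ph (dif E) x z"
      by (rule mat_then_assoc [OF mp mh E(2) C(1) E(1) xz, symmetric])
    also have "mat_then R (gens C) p (mat_then R (gens C) (dif C) h) x z =
        mat_then R (gens C) (mat_then R (gens C) p (dif C)) h x z"
      by (rule mat_then_assoc [OF mp C(2) mh C(1) C(1) xz, symmetric])
    \<comment> \<open>The only place where \<open>p\<close> has to be a chain map: the differential
      moves from behind \<open>p\<close> to the front.\<close>
    also have "\<dots> = mat_then R (gens C) (mat_then R (gens A) (dif A) p) h x z"
      by (rule mat_then_cong [OF matrix_on_mat_then [OF A(2) mp] mh xz])
        (simp_all add: chain_map_commute [OF p] xz)
    also have "\<dots> = mat_then R (gens A) (dif A) ?ph x z"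
      by (rule mat_then_assoc [OF A(2) mp mh A(1) C(1) xz])
    finally show ?thesis .
  qed
  ultimately show ?thesis
    using chain_homotopic_iff [OF matrix_on_mat_then [OF mp mats(1)] matrix_on_mat_then [OF mp mats(2)] fin(1,3)]
    by blast
qed

text \<open>The mirror image: the homotopy is \<open>h\<close> followed by \<open>p\<close>, and now
  the other boundary term needs \<open>p\<close> to commute with the differentials.\<close>

lemma chain_homotopic_then_right:
  assumes fg: "chain_homotopic R A C f g" and p: "chain_map R C E p"
    and mats: "matrix_on (gens A) (gens C) f" "matrix_on (gens A) (gens C) g"
    and fin: "finite_gcomplex A" "finite_gcomplex C" "finite_gcomplex E"
  shows "chain_homotopic R A E (mat_then R (gens C) f p) (mat_then R (gens C) g p)"
proof -
  let ?H = "\<lambda>h x y. mat_then R (gens C) h (dif C) x y \<oplus>\<^bsub>P\<^esub> mat_then R (gens A) (dif A) h x y"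
  from fg obtain h where h: "linear_map_of_hdegree R (-1) A C h"
    "\<And>x y. x \<in> gens A \<Longrightarrow> y \<in> gens C \<Longrightarrow> f x y = ?H h x y \<oplus>\<^bsub>P\<^esub> g x y"
    unfolding chain_homotopic_iff [OF mats fin(1,2)] by blast
  let ?hp = "mat_then R (gens C) h p"
  from fin have A: "finite (gens A)" "matrix_on (gens A) (gens A) (dif A)"
    and C: "finite (gens C)" "matrix_on (gens C) (gens C) (dif C)"
    and E: "finite (gens E)" "matrix_on (gens E) (gens E) (dif E)"
    by (auto simp: finite_gcomplex_def)
  note mp = chain_map_matrix_on [OF p] and mh = linear_map_matrix_on [OF h(1)]
  have mH: "matrix_on (gens A) (gens C) (?H h)"
    using matrix_on_mat_then [OF mh C(2)] matrix_on_mat_then [OF A(2) mh]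
    by (simp add: matrix_on_def)
  have "linear_map_of_hdegree R (-1) A E ?hp"
    using linear_map_then [of "-1" A C h 0 E p] p h(1) by (simp add: chain_map_def)
  moreover have "mat_then R (gens C) f p x z =
      (mat_then R (gens E) ?hp (dif E) x z \<oplus>\<^bsub>P\<^esub> mat_then R (gens A) (dif A) ?hp x z)
      \<oplus>\<^bsub>P\<^esub> mat_then R (gens C) g p x z"
    if xz: "x \<in> gens A" "z \<in> gens E" for x z
  proof -
    have "mat_then R (gens C) f p x z = mat_then R (gens C) (\<lambda>x y. ?H h x y \<oplus>\<^bsub>P\<^esub> g x y) p x z"
      using h(2) xz mats(1) by (intro mat_then_cong [OF _ mp xz, symmetric]) (auto simp: matrix_on_def)
    also have "\<dots> = mat_then R (gens C) (?H h) p x z \<oplus>\<^bsub>P\<^esub> mat_then R (gens C) g p x z"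
      by (rule mat_then_add_left [OF mH mats(2) mp xz])
    also have "mat_then R (gens C) (?H h) p x z =
        mat_then R (gens C) (mat_then R (gens C) h (dif C)) p x z \<oplus>\<^bsub>P\<^esub>
        mat_then R (gens C) (mat_then R (gens A) (dif A) h) p x z"
      by (rule mat_then_add_left [OF matrix_on_mat_then [OF mh C(2)] matrix_on_mat_then [OF A(2) mh] mp xz])
    also have "mat_then R (gens C) (mat_then R (gens A) (dif A) h) p x z = mat_then R (gens A) (dif A) ?hp x z"
      by (rule mat_then_assoc [OF A(2) mh mp A(1) C(1) xz])
    also have "mat_then R (gens C) (mat_then R (gens C) h (dif C)) p x z =
        mat_then R (gens C) h (mat_then R (gens C) (dif C) p) x z"
      by (rule mat_then_assoc [OF mh C(2) mp C(1) C(1) xz])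
    also have "\<dots> = mat_then R (gens C) h (mat_then R (gens E) p (dif E)) x z"
      by (rule mat_then_cong [OF mh matrix_on_mat_then [OF mp E(2)] xz])
        (simp_all add: chain_map_commute [OF p] xz)
    also have "\<dots> = mat_then R (gens E) ?hp (dif E) x z"
      by (rule mat_then_assoc [OF mh mp E(2) C(1) E(1) xz, symmetric])
    finally show ?thesis .
  qed
  ultimately show ?thesis
    using chain_homotopic_iff [OF matrix_on_mat_then [OF mats(1) mp] matrix_on_mat_then [OF mats(2) mp] fin(1,3)]
    by blast
qed

section \<open>Powers of \<open>G\<close> and composition of maps that are inverse up to
  them\<close>

lemma matrix_on_G_power_id: "matrix_on A A (G_power_id R n)"
  by (simp add: matrix_on_def G_power_id_def P_def[symmetric])

lemma chain_map_G_power_id: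
  assumes "finite_gcomplex C"
  shows "chain_map R C C (G_power_id R n)"
  using assms mat_then_G_power_id_left [of "gens C" "gens C" "dif C"]
    mat_then_G_power_id_right [of "gens C" "gens C" "dif C"]
  by (auto simp: chain_map_def finite_gcomplex_def linear_map_of_hdegree_def G_power_id_def P_def[symmetric])

lemma G_power_id_then:
  assumes "finite A" "x \<in> A" "z \<in> A"
  shows "mat_then R A (G_power_id R m) (G_power_id R n) x z = G_power_id R (m + n) x z"
  using assms
  by (subst mat_then_G_power_id_left [OF matrix_on_G_power_id])
    (auto simp: G_power_id_def monom_one_mult P_def[symmetric])

text \<open>In diagrammatic order, \<open>f f' g' g\<close> is homotopic to
  \<open>f G\<^sup>n g\<close>. This equals \<open>f g G\<^sup>n\<close> because scalars commute
  with \<open>g\<close>, and is therefore homotopic to \<open>G\<^sup>m G\<^sup>n\<close>.\<close>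

lemma chain_homotopic_G_power_then:
  assumes f: "chain_map R C D f" and g: "chain_map R D C g"
    and f': "chain_map R D E f'" and g': "chain_map R E D g'"
    and fg: "chain_homotopic R C C (mat_then R (gens D) f g) (G_power_id R m)"
    and fg': "chain_homotopic R D D (mat_then R (gens E) f' g') (G_power_id R n)"
    and fin: "finite_gcomplex C" "finite_gcomplex D" "finite_gcomplex E"
  shows "chain_homotopic R C C
    (mat_then R (gens E) (mat_then R (gens D) f f') (mat_then R (gens D) g' g)) (G_power_id R (m + n))"
proof -
  note mf = chain_map_matrix_on [OF f] and mg = chain_map_matrix_on [OF g]
    and mf' = chain_map_matrix_on [OF f'] and mg' = chain_map_matrix_on [OF g']
  note M = matrix_on_mat_then and G = matrix_on_G_power_id
  from fin have C: "finite (gens C)" and D: "finite (gens D)" and E: "finite (gens E)"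
    by (auto simp: finite_gcomplex_def)
  have "chain_homotopic R C D (mat_then R (gens D) f (mat_then R (gens E) f' g'))
      (mat_then R (gens D) f (G_power_id R n))"
    by (rule chain_homotopic_then_left [OF f fg' M [OF mf' mg'] G fin(1,2,2)])
  then have "chain_homotopic R C C
      (mat_then R (gens D) (mat_then R (gens D) f (mat_then R (gens E) f' g')) g)
      (mat_then R (gens D) (mat_then R (gens D) f (G_power_id R n)) g)"
    by (rule chain_homotopic_then_right [OF _ g M [OF mf M [OF mf' mg']] M [OF mf G] fin(1,2,1)])
  then have 1: "chain_homotopic R C C
      (mat_then R (gens E) (mat_then R (gens D) f f') (mat_then R (gens D) g' g))
      (mat_then R (gens C) (mat_then R (gens D) f g) (G_power_id R n))"
  \<comment> \<open>Both sides are rewritten on generators: the first by rebracketing, the second by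
    moving \<open>G\<^sup>n\<close> past \<open>g\<close>.\<close>
  proof (rule chain_homotopic_cong)
    fix x z assume xz: "x \<in> gens C" "z \<in> gens C"
    have "mat_then R (gens E) (mat_then R (gens D) f f') (mat_then R (gens D) g' g) x z =
        mat_then R (gens D) (mat_then R (gens E) (mat_then R (gens D) f f') g') g x z"
      by (rule mat_then_assoc [OF M [OF mf mf'] mg' mg E D xz, symmetric])
    also have "\<dots> = mat_then R (gens D) (mat_then R (gens D) f (mat_then R (gens E) f' g')) g x z"
      by (rule mat_then_cong [OF M [OF mf M [OF mf' mg']] mg xz])
        (simp_all add: mat_then_assoc [OF mf mf' mg' D E xz(1)])
    finally show "mat_then R (gens E) (mat_then R (gens D) f f') (mat_then R (gens D) g' g) x z =
        mat_then R (gens D) (mat_then R (gens D) f (mat_then R (gens E) f' g')) g x z" .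
    have "mat_then R (gens D) (mat_then R (gens D) f (G_power_id R n)) g x z =
        mat_then R (gens D) f (mat_then R (gens D) (G_power_id R n) g) x z"
      by (rule mat_then_assoc [OF mf G mg D D xz])
    also have "\<dots> = mat_then R (gens D) f (mat_then R (gens C) g (G_power_id R n)) x z"
      by (rule mat_then_cong [OF mf M [OF mg G] xz])
        (simp_all add: mat_then_G_power_id_left [OF mg D _ xz(2)] mat_then_G_power_id_right [OF mg C _ xz(2)])
    also have "\<dots> = mat_then R (gens C) (mat_then R (gens D) f g) (G_power_id R n) x z"
      by (rule mat_then_assoc [OF mf mg G D C xz, symmetric])
    finally show "mat_then R (gens C) (mat_then R (gens D) f g) (G_power_id R n) x z =
        mat_then R (gens D) (mat_then R (gens D) f (G_power_id R n)) g x z" by simp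
  qed
  have "chain_homotopic R C C (mat_then R (gens C) (mat_then R (gens D) f g) (G_power_id R n))
      (mat_then R (gens C) (G_power_id R m) (G_power_id R n))"
    by (rule chain_homotopic_then_right [OF fg chain_map_G_power_id [OF fin(1)] M [OF mf mg] G fin(1,1,1)])
  then have 2: "chain_homotopic R C C (mat_then R (gens C) (mat_then R (gens D) f g) (G_power_id R n))
      (G_power_id R (m + n))"
    by (rule chain_homotopic_cong) (simp_all add: G_power_id_then C)
  show ?thesis
    by (rule chain_homotopic_trans [OF 1 2 M [OF M [OF mf mf'] M [OF mg' mg]] M [OF M [OF mf mg] G] G fin(1,1)])
qed

text \<open>The triangle inequality at the level of maps. With exponent 0 and degrees 0 on one side,
  it transports a pair of maps along a homotopy equivalence without changing \<open>a\<close>,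
  \<open>b\<close> or \<open>n\<close>.\<close>

lemma G_inverse_maps_trans:
  assumes CD: "G_inverse_maps R C D a b m" and DE: "G_inverse_maps R D E a' b' n"
    and fin: "finite_gcomplex C" "finite_gcomplex D" "finite_gcomplex E"
  shows "G_inverse_maps R C E (a + a') (b + b') (m + n)"
proof -
  from CD obtain f g where f: "chain_map R C D f" "homogeneous R a C D f"
    and g: "chain_map R D C g" "homogeneous R b D C g"
    and gf: "chain_homotopic R D D (mat_then R (gens C) g f) (G_power_id R m)"
    and fg: "chain_homotopic R C C (mat_then R (gens D) f g) (G_power_id R m)"
    unfolding G_inverse_maps_def by blast
  from DE obtain f' g' where f': "chain_map R D E f'" "homogeneous R a' D E f'"
    and g': "chain_map R E D g'" "homogeneous R b' E D g'"
    and gf': "chain_homotopic R E E (mat_then R (gens D) g' f') (G_power_id R n)"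
    and fg': "chain_homotopic R D D (mat_then R (gens E) f' g') (G_power_id R n)"
    unfolding G_inverse_maps_def by blast
  have D: "finite (gens D)" using fin by (simp add: finite_gcomplex_def)
  show ?thesis
    unfolding G_inverse_maps_def
  proof (intro exI conjI)
    show "chain_map R C E (mat_then R (gens D) f f')"
      by (rule chain_map_then [OF f(1) f'(1) fin])
    show "chain_map R E C (mat_then R (gens D) g' g)"
      by (rule chain_map_then [OF g'(1) g(1) fin(3,2,1)])
    show "homogeneous R (a + a') C E (mat_then R (gens D) f f')"
      by (rule homogeneous_then [OF chain_map_matrix_on [OF f(1)] f(2) chain_map_matrix_on [OF f'(1)] f'(2) D])
    show "homogeneous R (b + b') E C (mat_then R (gens D) g' g)"
      using homogeneous_then [OF chain_map_matrix_on [OF g'(1)] g'(2) chain_map_matrix_on [OF g(1)] g(2) D]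
      by (simp add: add.commute)
    show "chain_homotopic R C C
        (mat_then R (gens E) (mat_then R (gens D) f f') (mat_then R (gens D) g' g)) (G_power_id R (m + n))"
      by (rule chain_homotopic_G_power_then [OF f(1) g(1) f'(1) g'(1) fg fg' fin])
    show "chain_homotopic R E E
        (mat_then R (gens C) (mat_then R (gens D) g' g) (mat_then R (gens D) f f')) (G_power_id R (m + n))"
      using chain_homotopic_G_power_then [OF g'(1) f'(1) g(1) f(1) gf' gf fin(3,2,1)]
      by (simp add: add.commute)
  qed
qed


lemma G_inverse_maps_sym: "G_inverse_maps R C E a b n \<Longrightarrow> G_inverse_maps R E C b a n"
  unfolding G_inverse_maps_def by blast

lemma graded_homotopy_equivalent_G_inverse_maps:
  "graded_homotopy_equivalent R C E \<Longrightarrow> G_inverse_maps R C E 0 0 0"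
  unfolding graded_homotopy_equivalent_def G_inverse_maps_def by blast

section \<open>Complexes in standard form\<close>

lemma gens_standard_complex:
  "gens (standard_complex R s T) = insert None (Some ` ({..<length T} \<times> UNIV))"
  by (simp add: standard_complex_def)

lemma dif_standard_complex:
  "dif (standard_complex R s T) x y = (if \<exists>m<length T. x = Some (m, False) \<and> y = Some (m, True)
    then monom P \<one> (snd (snd (T ! fst (the x)))) else \<zero>\<^bsub>P\<^esub>)"
  by (simp only: standard_complex_def P_def gcomplex.simps)

lemma finite_standard_complex: "finite_gcomplex (standard_complex R s T)"
  by (auto simp: finite_gcomplex_def matrix_on_def gens_standard_complex dif_standard_complex)

text \<open>Multiplication by \<open>G\<^sup>k\<close> only shifts coefficients: the coefficient of
  the product at \<open>k + n\<close> is that of \<open>p\<close> at \<open>n\<close>.\<close>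

lemma monom_one_mult_eq_zeroD:
  assumes "p \<in> carrier P" "monom P \<one> k \<otimes>\<^bsub>P\<^esub> p = \<zero>\<^bsub>P\<^esub>"
  shows "p = \<zero>\<^bsub>P\<^esub>"
proof (rule up_eqI)
  fix n
  show "coeff P p n = coeff P \<zero>\<^bsub>P\<^esub> n"
    using coeff_monom_mult [OF R.one_closed assms(1), of k n] assms by simp
qed (use assms in auto)

text \<open>Evaluate the chain map identity at the entry from \<open>None\<close> to
  \<open>Some (m, True)\<close>. Only \<open>Some (m, False)\<close> has a differential into the
  latter and \<open>None\<close> has none at all, so \<open>G\<^sup>k\<close> times the entry in
  question is zero.\<close>

lemma chain_map_standard_complex_from_None:
  assumes f: "chain_map R (standard_complex R s T) (standard_complex R s' T') f"
    and m: "m < length T'"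
  shows "f None (Some (m, False)) = \<zero>\<^bsub>P\<^esub>"
proof -
  let ?C = "standard_complex R s T" and ?E = "standard_complex R s' T'"
  have mems: "None \<in> gens ?C" "Some (m, True) \<in> gens ?E" "Some (m, False) \<in> gens ?E"
    using m by (auto simp: gens_standard_complex)
  note mf = chain_map_matrix_on [OF f]
  have fin: "finite (gens ?E)" and mE: "matrix_on (gens ?E) (gens ?E) (dif ?E)"
    and mC: "matrix_on (gens ?C) (gens ?C) (dif ?C)"
    using finite_standard_complex by (auto simp: finite_gcomplex_def)
  have "f None (Some (m, False)) \<otimes>\<^bsub>P\<^esub> dif ?E (Some (m, False)) (Some (m, True)) =
      mat_then R (gens ?E) f (dif ?E) None (Some (m, True))"
    by (rule mat_then_single [OF mf mE fin mems, symmetric]) (auto simp: dif_standard_complex)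
  also have "\<dots> = mat_then R (gens ?C) (dif ?C) f None (Some (m, True))"
    by (rule chain_map_commute [OF f mems(1,2)])
  also have "\<dots> = \<zero>\<^bsub>P\<^esub>"
    by (rule mat_then_zero [OF mC mf mems(1,2)]) (simp add: dif_standard_complex)
  finally have "monom P \<one> (snd (snd (T' ! m))) \<otimes>\<^bsub>P\<^esub> f None (Some (m, False)) = \<zero>\<^bsub>P\<^esub>"
    using m matrix_onD [OF mf mems(1,3)] by (simp add: dif_standard_complex P.m_comm)
  then show ?thesis
    by (rule monom_one_mult_eq_zeroD [OF matrix_onD [OF mf mems(1,3)]])
qed

text \<open>Dually, evaluate at the entry from \<open>Some (m, False)\<close> to
  \<open>None\<close>: nothing has a differential into \<open>None\<close>.\<close>

lemma chain_map_standard_complex_to_None: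
  assumes f: "chain_map R (standard_complex R s T) (standard_complex R s' T') f"
    and m: "m < length T"
  shows "f (Some (m, True)) None = \<zero>\<^bsub>P\<^esub>"
proof -
  let ?C = "standard_complex R s T" and ?E = "standard_complex R s' T'"
  have mems: "Some (m, False) \<in> gens ?C" "None \<in> gens ?E" "Some (m, True) \<in> gens ?C"
    using m by (auto simp: gens_standard_complex)
  note mf = chain_map_matrix_on [OF f]
  have fin: "finite (gens ?C)" and mE: "matrix_on (gens ?E) (gens ?E) (dif ?E)"
    and mC: "matrix_on (gens ?C) (gens ?C) (dif ?C)"
    using finite_standard_complex by (auto simp: finite_gcomplex_def)
  have "dif ?C (Some (m, False)) (Some (m, True)) \<otimes>\<^bsub>P\<^esub> f (Some (m, True)) None =
      mat_then R (gens ?C) (dif ?C) f (Some (m, False)) None"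
    by (rule mat_then_single [OF mC mf fin mems, symmetric]) (auto simp: dif_standard_complex)
  also have "\<dots> = mat_then R (gens ?E) f (dif ?E) (Some (m, False)) None"
    by (rule chain_map_commute [OF f mems(1,2), symmetric])
  also have "\<dots> = \<zero>\<^bsub>P\<^esub>"
    by (rule mat_then_zero [OF mf mE mems(1,2)]) (simp add: dif_standard_complex)
  finally have "monom P \<one> (snd (snd (T ! m))) \<otimes>\<^bsub>P\<^esub> f (Some (m, True)) None = \<zero>\<^bsub>P\<^esub>"
    using m by (simp add: dif_standard_complex)
  then show ?thesis
    by (rule monom_one_mult_eq_zeroD [OF matrix_onD [OF mf mems(3,2)]])
qed

text \<open>Everything is read off from the homotopy relation at the single entry from
  \<open>None\<close> to \<open>None\<close>.\<close>

lemma G_inverse_maps_standard_complex: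
  assumes G: "G_inverse_maps R (standard_complex R s T) (standard_complex R s' T') a b n"
    and one: "\<one> \<noteq> \<zero>"
  obtains i j where "i + j = n" "s' - s = a + 2 * int i" "s - s' = b + 2 * int j"
proof -
  let ?C = "standard_complex R s T" and ?E = "standard_complex R s' T'"
  from G obtain f g where f: "chain_map R ?C ?E f" "homogeneous R a ?C ?E f"
    and g: "chain_map R ?E ?C g" "homogeneous R b ?E ?C g"
    and "chain_homotopic R ?C ?C (mat_then R (gens ?E) f g) (G_power_id R n)"
    unfolding G_inverse_maps_def by blast
  note mf = chain_map_matrix_on [OF f(1)] and mg = chain_map_matrix_on [OF g(1)]
  have fin: "finite (gens ?E)" and mC: "matrix_on (gens ?C) (gens ?C) (dif ?C)"
    using finite_standard_complex by (auto simp: finite_gcomplex_def)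
  have N: "None \<in> gens ?C" "None \<in> gens ?E" by (auto simp: gens_standard_complex)
  from \<open>chain_homotopic _ _ _ _ _\<close> obtain h where h: "linear_map_of_hdegree R (-1) ?C ?C h"
    and H: "\<forall>x\<in>gens ?C. \<forall>y\<in>gens ?C. mat_then R (gens ?E) f g x y =
      (mat_then R (gens ?C) h (dif ?C) x y \<oplus>\<^bsub>P\<^esub> mat_then R (gens ?C) (dif ?C) h x y)
      \<oplus>\<^bsub>P\<^esub> G_power_id R n x y"
    unfolding chain_homotopic_iff [OF matrix_on_mat_then [OF mf mg] matrix_on_G_power_id
        finite_standard_complex finite_standard_complex]
    by blast
  note eq = bspec [OF bspec [OF H N(1)] N(1)]
  note mh = linear_map_matrix_on [OF h]
  \<comment> \<open>The differential neither enters nor leaves \<open>None\<close>, so both homotopy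
    terms vanish whatever \<open>h\<close> is.\<close>
  have "mat_then R (gens ?C) h (dif ?C) None None = \<zero>\<^bsub>P\<^esub>"
    by (rule mat_then_zero [OF mh mC N(1) N(1)]) (simp add: dif_standard_complex)
  moreover have "mat_then R (gens ?C) (dif ?C) h None None = \<zero>\<^bsub>P\<^esub>"
    by (rule mat_then_zero [OF mC mh N(1) N(1)]) (simp add: dif_standard_complex)
  moreover have "mat_then R (gens ?E) f g None None = f None None \<otimes>\<^bsub>P\<^esub> g None None"
  proof (rule mat_then_single [OF mf mg fin N(1) N(1) N(2)])
    fix y assume "y \<in> gens ?E" "y \<noteq> None"
    then obtain m c where "y = Some (m, c)" "m < length T'" by (auto simp: gens_standard_complex)
    \<comment> \<open>For a source (\<open>c = False\<close>) the factor from \<open>f\<close>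
      vanishes, for a target (\<open>c = True\<close>) the factor from \<open>g\<close>.\<close>
    then show "f None y = \<zero>\<^bsub>P\<^esub> \<or> g y None = \<zero>\<^bsub>P\<^esub>"
      using chain_map_standard_complex_from_None [OF f(1)] chain_map_standard_complex_to_None [OF g(1)]
      by (cases c) auto
  qed
  ultimately have "f None None \<otimes>\<^bsub>P\<^esub> g None None = monom P \<one> n"
    using eq by (simp add: G_power_id_def P_def[symmetric])
  \<comment> \<open>Nontriviality of the ring makes the coefficient of \<open>G\<^sup>n\<close> in
    \<open>monom P \<one> n\<close> nonzero.\<close>
  then have "coeff P (f None None \<otimes>\<^bsub>P\<^esub> g None None) n \<noteq> \<zero>"
    using one by (simp del: coeff_mult)
  then obtain i j where ij: "i + j = n" "coeff P (f None None) i \<noteq> \<zero>" "coeff P (g None None) j \<noteq> \<zero>"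
    by (rule coeff_mult_nonzeroE [OF matrix_onD [OF mf N] matrix_onD [OF mg N(2,1)]])
  have "s' - 2 * int i = s + a"
    using f(2) N ij(2) unfolding homogeneous_def P_def[symmetric] by (force simp: standard_complex_def)
  moreover have "s - 2 * int j = s' + b"
    using g(2) N ij(3) unfolding homogeneous_def P_def[symmetric] by (force simp: standard_complex_def)
  ultimately show thesis using that [OF ij(1)] by simp
qed

end

section \<open>Base change from the integers\<close>

text \<open>For multiplicativity, the multiple by \<open>l\<close> is pulled out of the second
  factor, and iterated integer multiples are multiples by the product.\<close>

lemma (in cring) int_multiple_ring_hom: "(\<lambda>k::int. [k] \<cdot> \<one>) \<in> ring_hom \<Z> R"
proof (rule ring_hom_memI)
  fix k l :: int
  have "([k] \<cdot> \<one>) \<otimes> ([l] \<cdot> \<one>) = [l] \<cdot> (([k] \<cdot> \<one>) \<otimes> \<one>)"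
    by (intro add_pow_rdistr_int) auto
  also have "\<dots> = [(k * l)] \<cdot> \<one>"
    using add.int_pow_pow [of \<one> l k] by (simp add: mult.commute)
  finally show "[(k \<otimes>\<^bsub>\<Z>\<^esub> l)] \<cdot> \<one> = ([k] \<cdot> \<one>) \<otimes> ([l] \<cdot> \<one>)" by simp
qed (auto simp: add.int_pow_mult)

interpretation int_UP: UP_matrices \<Z> "UP \<Z>"
  by (intro UP_matrices.intro UP_cring.intro int_is_cring reflexive)

context UP_matrices
begin

lemma int_multiple_hom: "ring_hom_cring \<Z> R (\<lambda>k. [k] \<cdot> \<one>)"
  by (intro ring_hom_cring.intro ring_hom_cring_axioms.intro int_is_cring R.is_cring R.int_multiple_ring_hom)

lemma int_multiple_zero: "[(0::int)] \<cdot> \<one> = \<zero>"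
  using ring_hom_cring.hom_zero [OF int_multiple_hom] by simp

text \<open>The image is a bare sequence, so it must be shown to be eventually zero: a degree bound
  for \<open>p\<close> persists because 0 maps to 0.\<close>

lemma poly_base_change_closed:
  assumes "p \<in> carrier (UP \<Z>)"
  shows "poly_base_change R p \<in> carrier P"
proof -
  have p: "p \<in> up \<Z>"
    using assms by (simp add: UP_def)
  then obtain n where n: "bound 0 n p"
    by (auto simp: up_def)
  have eq: "poly_base_change R p = (\<lambda>i. [p i] \<cdot> \<one>)"
    using p by (simp add: poly_base_change_def UP_def)
  have "bound \<zero> n (poly_base_change R p)"
    using n by (auto simp: eq bound_def int_multiple_zero)
  then have "poly_base_change R p \<in> up R"
    by (intro mem_upI) (auto simp: eq)
  then show ?thesis
    by (simp add: P_def UP_def)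
qed

text \<open>\<open>coeff\<close> is evaluation only on \<open>up R\<close>, so the closure lemma has
  to come first.\<close>

lemma coeff_poly_base_change:
  assumes "p \<in> carrier (UP \<Z>)"
  shows "coeff P (poly_base_change R p) n = [coeff (UP \<Z>) p n] \<cdot> \<one>"
proof -
  have "poly_base_change R p \<in> up R"
    using poly_base_change_closed [OF assms] by (simp add: P_def UP_def)
  then have "coeff P (poly_base_change R p) n = poly_base_change R p n"
    by (simp add: P_def UP_def)
  then show ?thesis by (simp add: poly_base_change_def)
qed

lemma poly_base_change_monom:
  "poly_base_change R (monom (UP \<Z>) k n) = monom P ([k] \<cdot> \<one>) n"
proof (rule up_eqI)
  fix i
  show "coeff P (poly_base_change R (monom (UP \<Z>) k n)) i = coeff P (monom P ([k] \<cdot> \<one>) n) i"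
    by (simp add: coeff_poly_base_change int_multiple_zero)
qed (simp_all add: poly_base_change_closed)

lemma poly_base_change_hom: "ring_hom_cring (UP \<Z>) P (poly_base_change R)"
proof (intro ring_hom_cring.intro ring_hom_cring_axioms.intro ring_hom_memI)
  interpret h: ring_hom_cring \<Z> R "\<lambda>k. [k] \<cdot> \<one>" by (rule int_multiple_hom)
  show "cring (UP \<Z>)" by (rule int_UP.UP_cring)
  show "cring P" by (rule UP_cring)
  show "poly_base_change R p \<in> carrier P" if "p \<in> carrier (UP \<Z>)" for p
    using that by (rule poly_base_change_closed)
  show "poly_base_change R (p \<oplus>\<^bsub>UP \<Z>\<^esub> q) = poly_base_change R p \<oplus>\<^bsub>P\<^esub> poly_base_change R q"
    if "p \<in> carrier (UP \<Z>)" "q \<in> carrier (UP \<Z>)" for p q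
    using that h.hom_add by (intro up_eqI) (simp_all add: coeff_poly_base_change poly_base_change_closed)
  show "poly_base_change R (p \<otimes>\<^bsub>UP \<Z>\<^esub> q) = poly_base_change R p \<otimes>\<^bsub>P\<^esub> poly_base_change R q"
    if "p \<in> carrier (UP \<Z>)" "q \<in> carrier (UP \<Z>)" for p q
  proof (rule up_eqI)
    fix n
    \<comment> \<open>Multiplicativity: apply the homomorphism on coefficients to the convolution
      sum.\<close>
    have "[(\<Sum>i\<le>n. coeff (UP \<Z>) p i * coeff (UP \<Z>) q (n - i))] \<cdot> \<one> =
        (\<Oplus>i\<in>{..n}. [(coeff (UP \<Z>) p i * coeff (UP \<Z>) q (n - i))] \<cdot> \<one>)"
      by (rule h.hom_finsum [unfolded o_def]) auto
    also have "\<dots> = (\<Oplus>i\<in>{..n}. ([coeff (UP \<Z>) p i] \<cdot> \<one>) \<otimes> ([coeff (UP \<Z>) q (n - i)] \<cdot> \<one>))"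
      using h.hom_mult by (intro R.finsum_cong' refl) auto
    finally show "coeff P (poly_base_change R (p \<otimes>\<^bsub>UP \<Z>\<^esub> q)) n =
        coeff P (poly_base_change R p \<otimes>\<^bsub>P\<^esub> poly_base_change R q) n"
      using that by (simp only: coeff_poly_base_change poly_base_change_closed coeff_mult
          int_UP.coeff_mult int_UP.UP_mult_closed)
  qed (use that in \<open>simp_all add: poly_base_change_closed\<close>)
  show "poly_base_change R \<one>\<^bsub>UP \<Z>\<^esub> = \<one>\<^bsub>P\<^esub>"
    by (intro up_eqI) (simp_all add: coeff_poly_base_change poly_base_change_closed)
qed

lemma mat_then_base_change:
  assumes "int_UP.matrix_on A B M" "int_UP.matrix_on B C N" "x \<in> A" "z \<in> C"
  shows "mat_then R B (\<lambda>x y. poly_base_change R (M x y)) (\<lambda>x y. poly_base_change R (N x y)) x z =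
    poly_base_change R (mat_then \<Z> B M N x z)"
proof -
  interpret h: ring_hom_cring "UP \<Z>" P "poly_base_change R" by (rule poly_base_change_hom)
  have "poly_base_change R (mat_then \<Z> B M N x z) =
      (\<Oplus>\<^bsub>P\<^esub>y\<in>B. poly_base_change R (M x y \<otimes>\<^bsub>UP \<Z>\<^esub> N y z))"
    unfolding int_UP.mat_then_eq using assms
    by (subst h.hom_finsum) (auto simp: int_UP.matrix_on_def o_def)
  also have "\<dots> = (\<Oplus>\<^bsub>P\<^esub>y\<in>B. poly_base_change R (M x y) \<otimes>\<^bsub>P\<^esub> poly_base_change R (N y z))"
    using assms by (intro P.finsum_cong' refl) (auto simp: int_UP.matrix_on_def)
  finally show ?thesis by (simp add: mat_then_eq)
qed

section \<open>Base change of complexes, chain maps and homotopies\<close>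

lemma base_change_simps:
  "gens (base_change R C) = gens C" "hdeg (base_change R C) = hdeg C" "qdeg (base_change R C) = qdeg C"
  "dif (base_change R C) = (\<lambda>x y. poly_base_change R (dif C x y))"
  by (simp_all add: base_change_def)

lemma finite_gcomplex_base_change: "int_UP.finite_gcomplex C \<Longrightarrow> finite_gcomplex (base_change R C)"
  by (auto simp: finite_gcomplex_def int_UP.finite_gcomplex_def matrix_on_def int_UP.matrix_on_def
      base_change_simps poly_base_change_closed)

lemma linear_map_base_change:
  assumes "linear_map_of_hdegree \<Z> e C E f"
  shows "linear_map_of_hdegree R e (base_change R C) (base_change R E) (\<lambda>x y. poly_base_change R (f x y))"
proof -
  interpret h: ring_hom_cring "UP \<Z>" P "poly_base_change R" by (rule poly_base_change_hom)
  show ?thesis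
    using assms h.hom_closed h.hom_zero
    unfolding linear_map_of_hdegree_def base_change_simps P_def[symmetric] by metis
qed

lemma chain_map_base_change:
  assumes f: "chain_map \<Z> C E f" and fin: "int_UP.finite_gcomplex C" "int_UP.finite_gcomplex E"
  shows "chain_map R (base_change R C) (base_change R E) (\<lambda>x y. poly_base_change R (f x y))"
  unfolding chain_map_def base_change_simps
proof (intro conjI ballI)
  show "linear_map_of_hdegree R 0 (base_change R C) (base_change R E) (\<lambda>x y. poly_base_change R (f x y))"
    using f by (simp add: chain_map_def linear_map_base_change)
  fix x y assume xy: "x \<in> gens C" "y \<in> gens E"
  have C: "int_UP.matrix_on (gens C) (gens C) (dif C)" and E: "int_UP.matrix_on (gens E) (gens E) (dif E)"
    using fin by (simp_all add: int_UP.finite_gcomplex_def)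
  show "mat_then R (gens E) (\<lambda>x y. poly_base_change R (f x y)) (\<lambda>x y. poly_base_change R (dif E x y)) x y =
      mat_then R (gens C) (\<lambda>x y. poly_base_change R (dif C x y)) (\<lambda>x y. poly_base_change R (f x y)) x y"
    by (simp add: mat_then_base_change [OF int_UP.chain_map_matrix_on [OF f] E xy]
        mat_then_base_change [OF C int_UP.chain_map_matrix_on [OF f] xy] int_UP.chain_map_commute [OF f xy])
qed

text \<open>A coefficient that survives in \<open>R\<close> comes from a nonzero integral one, so no
  new monomials appear and the degree condition is inherited.\<close>

lemma homogeneous_base_change:
  assumes "homogeneous \<Z> d C E f" "int_UP.matrix_on (gens C) (gens E) f"
  shows "homogeneous R d (base_change R C) (base_change R E) (\<lambda>x y. poly_base_change R (f x y))"
  unfolding homogeneous_def base_change_simps P_def[symmetric]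
proof (intro ballI allI impI)
  fix x y k
  assume xy: "x \<in> gens C" "y \<in> gens E" and "coeff P (poly_base_change R (f x y)) k \<noteq> \<zero>"
  then have "[coeff (UP \<Z>) (f x y) k] \<cdot> \<one> \<noteq> \<zero>"
    by (simp add: coeff_poly_base_change int_UP.matrix_onD [OF assms(2) xy])
  then have "coeff (UP \<Z>) (f x y) k \<noteq> 0" using int_multiple_zero by metis
  then show "qdeg E y - 2 * int k = qdeg C x + d"
    using assms(1) xy unfolding homogeneous_def by auto
qed

lemma chain_homotopic_base_change:
  assumes fg: "chain_homotopic \<Z> C E f g"
    and mats: "int_UP.matrix_on (gens C) (gens E) f" "int_UP.matrix_on (gens C) (gens E) g"
    and fin: "int_UP.finite_gcomplex C" "int_UP.finite_gcomplex E"
  shows "chain_homotopic R (base_change R C) (base_change R E)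
    (\<lambda>x y. poly_base_change R (f x y)) (\<lambda>x y. poly_base_change R (g x y))"
proof -
  interpret h: ring_hom_cring "UP \<Z>" P "poly_base_change R" by (rule poly_base_change_hom)
  from fg obtain h where h: "linear_map_of_hdegree \<Z> (-1) C E h"
    and H: "\<forall>x\<in>gens C. \<forall>y\<in>gens E. f x y \<ominus>\<^bsub>UP \<Z>\<^esub> g x y =
      mat_then \<Z> (gens E) h (dif E) x y \<oplus>\<^bsub>UP \<Z>\<^esub> mat_then \<Z> (gens C) (dif C) h x y"
    unfolding chain_homotopic_def by blast
  have C: "int_UP.matrix_on (gens C) (gens C) (dif C)" and E: "int_UP.matrix_on (gens E) (gens E) (dif E)"
    using fin by (simp_all add: int_UP.finite_gcomplex_def)
  note mh = int_UP.linear_map_matrix_on [OF h]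
  show ?thesis
    unfolding chain_homotopic_def base_change_simps P_def[symmetric]
  proof (intro exI conjI ballI)
    show "linear_map_of_hdegree R (-1) (base_change R C) (base_change R E) (\<lambda>x y. poly_base_change R (h x y))"
      by (rule linear_map_base_change [OF h])
    fix x y assume xy: "x \<in> gens C" "y \<in> gens E"
    have "poly_base_change R (f x y) \<ominus>\<^bsub>P\<^esub> poly_base_change R (g x y) =
        poly_base_change R (f x y \<ominus>\<^bsub>UP \<Z>\<^esub> g x y)"
      using int_UP.matrix_onD [OF mats(1) xy] int_UP.matrix_onD [OF mats(2) xy]
      by (simp add: a_minus_def)
    also have "\<dots> = poly_base_change R (mat_then \<Z> (gens E) h (dif E) x y) \<oplus>\<^bsub>P\<^esub>
        poly_base_change R (mat_then \<Z> (gens C) (dif C) h x y)"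
      using H xy int_UP.matrix_onD [OF int_UP.matrix_on_mat_then [OF mh E] xy]
        int_UP.matrix_onD [OF int_UP.matrix_on_mat_then [OF C mh] xy]
      by simp
    finally show "poly_base_change R (f x y) \<ominus>\<^bsub>P\<^esub> poly_base_change R (g x y) =
        mat_then R (gens E) (\<lambda>x y. poly_base_change R (h x y)) (\<lambda>x y. poly_base_change R (dif E x y)) x y \<oplus>\<^bsub>P\<^esub>
        mat_then R (gens C) (\<lambda>x y. poly_base_change R (dif C x y)) (\<lambda>x y. poly_base_change R (h x y)) x y"
      by (simp add: mat_then_base_change [OF mh E xy] mat_then_base_change [OF C mh xy])
  qed
qed

lemma G_power_id_base_change: "poly_base_change R (G_power_id \<Z> n x y) = G_power_id R n x y"
proof -
  interpret h: ring_hom_cring "UP \<Z>" P "poly_base_change R" by (rule poly_base_change_hom)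
  show ?thesis by (simp add: G_power_id_def poly_base_change_monom P_def[symmetric])
qed

text \<open>The point is that \<open>a\<close>, \<open>b\<close> and \<open>n\<close> do not depend
  on \<open>R\<close>: one integral pair of maps serves all fields with the same degrees.\<close>

lemma G_inverse_maps_base_change:
  assumes G: "G_inverse_maps \<Z> C E a b n"
    and fin: "int_UP.finite_gcomplex C" "int_UP.finite_gcomplex E"
  shows "G_inverse_maps R (base_change R C) (base_change R E) a b n"
proof -
  from G obtain f g where f: "chain_map \<Z> C E f" "homogeneous \<Z> a C E f"
    and g: "chain_map \<Z> E C g" "homogeneous \<Z> b E C g"
    and gf: "chain_homotopic \<Z> E E (mat_then \<Z> (gens C) g f) (G_power_id \<Z> n)"
    and fg: "chain_homotopic \<Z> C C (mat_then \<Z> (gens E) f g) (G_power_id \<Z> n)"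
    unfolding G_inverse_maps_def by blast
  note mf = int_UP.chain_map_matrix_on [OF f(1)] and mg = int_UP.chain_map_matrix_on [OF g(1)]
  show ?thesis
    unfolding G_inverse_maps_def
  proof (intro exI conjI)
    show "chain_map R (base_change R C) (base_change R E) (\<lambda>x y. poly_base_change R (f x y))"
      by (rule chain_map_base_change [OF f(1) fin])
    show "chain_map R (base_change R E) (base_change R C) (\<lambda>x y. poly_base_change R (g x y))"
      by (rule chain_map_base_change [OF g(1) fin(2,1)])
    show "homogeneous R a (base_change R C) (base_change R E) (\<lambda>x y. poly_base_change R (f x y))"
      by (rule homogeneous_base_change [OF f(2) mf])
    show "homogeneous R b (base_change R E) (base_change R C) (\<lambda>x y. poly_base_change R (g x y))"
      by (rule homogeneous_base_change [OF g(2) mg])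
    show "chain_homotopic R (base_change R E) (base_change R E)
        (mat_then R (gens (base_change R C)) (\<lambda>x y. poly_base_change R (g x y)) (\<lambda>x y. poly_base_change R (f x y)))
        (G_power_id R n)"
      using chain_homotopic_base_change [OF gf int_UP.matrix_on_mat_then [OF mg mf]
          int_UP.matrix_on_G_power_id fin(2,2)]
      by (rule chain_homotopic_cong)
        (simp_all add: base_change_simps G_power_id_base_change mat_then_base_change [OF mg mf])
    show "chain_homotopic R (base_change R C) (base_change R C)
        (mat_then R (gens (base_change R E)) (\<lambda>x y. poly_base_change R (f x y)) (\<lambda>x y. poly_base_change R (g x y)))
        (G_power_id R n)"
      using chain_homotopic_base_change [OF fg int_UP.matrix_on_mat_then [OF mf mg]
          int_UP.matrix_on_G_power_id fin(1,1)]
      by (rule chain_homotopic_cong)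
        (simp_all add: base_change_simps G_power_id_base_change mat_then_base_change [OF mf mg])
  qed
qed

end

text \<open>\<open>CBN \<Z>\<close> is itself defined by a base change, along the identity of
  \<open>\<Z>\<close>; this lemma identifies it with the integral complex.\<close>

lemma poly_base_change_int: "p \<in> carrier (UP \<Z>) \<Longrightarrow> poly_base_change \<Z> p = p"
proof -
  assume p: "p \<in> carrier (UP \<Z>)"
  have mult: "[k] \<cdot>\<^bsub>\<Z>\<^esub> (1::int) = k" for k :: int
  proof -
    have nat: "[m] \<cdot>\<^bsub>\<Z>\<^esub> (1::int) = int m" for m :: nat
      by (induction m) (simp_all add: add_pow_def)
    show ?thesis
      by (cases "k \<ge> 0") (simp_all add: add_pow_int_ge add_pow_int_lt nat int_a_inv_eq)
  qed
  show ?thesis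
    using p by (auto simp: poly_base_change_def mult UP_def)
qed

section \<open>The complex CBN and the Rasmussen invariant\<close>

text \<open>Circles are classes of edges, and each of the finitely many edges has one class.\<close>

lemma finite_free_circles: "finite (free_circles D v)"
proof -
  have "finite (circles D v)"
    by (simp add: circles_def quotient_def edges_def)
  then show ?thesis by (simp add: free_circles_def)
qed

lemma finite_cbn_gens: "finite (cbn_gens D)"
proof -
  have "cbn_gens D = (SIGMA v:Pow (crossings D). Pow (free_circles D v))"
    by (auto simp: cbn_gens_def)
  then show ?thesis by (simp add: finite_free_circles)
qed

lemma cbn_dif_closed: "cbn_dif D x y \<in> carrier (UP \<Z>)"
proof -
  have "edge_map D x y \<in> carrier (UP \<Z>)"
    by (auto simp: edge_map_def mult_coeff_def comult_coeff_def Let_def split: prod.split)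
  then show ?thesis
    by (simp add: cbn_dif_def)
qed

lemma finite_CBN_integral: "int_UP.finite_gcomplex (CBN_integral D)"
  by (simp add: int_UP.finite_gcomplex_def int_UP.matrix_on_def CBN_integral_def finite_cbn_gens cbn_dif_closed)

lemma CBN_int: "CBN \<Z> D = CBN_integral D"
  by (simp add: CBN_def base_change_def CBN_integral_def poly_base_change_int cbn_dif_closed)

context UP_matrices
begin

lemma finite_CBN: "finite_gcomplex (CBN R D)"
  unfolding CBN_def by (rule finite_gcomplex_base_change [OF finite_CBN_integral])

lemma G_inverse_maps_CBN_base_change:
  "G_inverse_maps \<Z> (CBN \<Z> D) (CBN \<Z> D') a b n \<Longrightarrow> G_inverse_maps R (CBN R D) (CBN R D') a b n"
  unfolding CBN_int unfolding CBN_def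
  by (rule G_inverse_maps_base_change [OF _ finite_CBN_integral finite_CBN_integral])

text \<open>Compose along standard form, \<open>CBN R D\<close>, \<open>CBN R D'\<close>, standard
  form. The outer maps are homotopy equivalences, with degrees and exponent 0, so the standard
  complexes inherit \<open>a\<close>, \<open>b\<close> and \<open>n\<close>.\<close>

lemma rasmussen_invariant_G_inverse_maps:
  assumes G: "G_inverse_maps R (CBN R D) (CBN R D') a b n"
    and s: "rasmussen_invariant R D s" "rasmussen_invariant R D' s'" and one: "\<one> \<noteq> \<zero>"
  obtains i j where "i + j = n" "s' - s = a + 2 * int i" "s - s' = b + 2 * int j"
proof -
  from s obtain T T' where "graded_homotopy_equivalent R (CBN R D) (standard_complex R s T)"
    "graded_homotopy_equivalent R (CBN R D') (standard_complex R s' T')"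
    unfolding rasmussen_invariant_def by blast
  then have S: "G_inverse_maps R (standard_complex R s T) (CBN R D) 0 0 0"
    and S': "G_inverse_maps R (CBN R D') (standard_complex R s' T') 0 0 0"
    by (auto intro: graded_homotopy_equivalent_G_inverse_maps G_inverse_maps_sym)
  have "G_inverse_maps R (standard_complex R s T) (CBN R D') a b n"
    using G_inverse_maps_trans [OF S G finite_standard_complex finite_CBN finite_CBN] by simp
  from G_inverse_maps_trans [OF this S' finite_standard_complex finite_CBN finite_standard_complex]
  have "G_inverse_maps R (standard_complex R s T) (standard_complex R s' T') a b n" by simp
  then show thesis
    using one that by (rule G_inverse_maps_standard_complex)
qed

end

section \<open>Coefficient fields, infima and suprema\<close>

lemma rasmussen_invariant_field:
  assumes "Ring.field F" "G_inverse_maps F (CBN F D) (CBN F D') a b n"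
    and "rasmussen_invariant F D s" "rasmussen_invariant F D' s'"
  obtains i j where "i + j = n" "s' - s = a + 2 * int i" "s - s' = b + 2 * int j"
proof -
  interpret field F by fact
  interpret UP_matrices F "UP F"
    by (intro UP_matrices.intro UP_cring.intro is_cring reflexive)
  show thesis
    by (rule rasmussen_invariant_G_inverse_maps [OF assms(2-4) one_not_zero that])
qed

lemma G_inverse_maps_CBN_int_field:
  assumes "Ring.field F" "G_inverse_maps \<Z> (CBN \<Z> D) (CBN \<Z> D') a b n"
  shows "G_inverse_maps F (CBN F D) (CBN F D') a b n"
proof -
  interpret field F by fact
  interpret UP_matrices F "UP F"
    by (intro UP_matrices.intro UP_cring.intro is_cring reflexive)
  show ?thesis by (rule G_inverse_maps_CBN_base_change [OF assms(2)])
qed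

text \<open>By well-ordering a finite infimum is attained. A bound on \<open>lam\<close> or
  \<open>lam0\<close> thus reduces to a bound for one actual pair of maps, the infinite case being
  trivial.\<close>

lemma Inf_enat_cases:
  fixes Q :: "nat \<Rightarrow> bool"
  obtains "Inf {enat n | n. Q n} = \<infinity>" | n where "Q n" "Inf {enat n | n. Q n} = enat n"
proof (cases "{enat n | n. Q n} = {}")
  case True
  then show thesis using that(1) by (simp add: Inf_enat_def)
next
  case False
  then obtain x where "x \<in> {enat n | n. Q n}" by blast
  then have "(LEAST x. x \<in> {enat n | n. Q n}) \<in> {enat n | n. Q n}" by (rule LeastI)
  with False have "Inf {enat n | n. Q n} \<in> {enat n | n. Q n}" by (simp only: Inf_enat_def if_False)
  then show thesis using that(2) by auto
qed

lemma max_over_fields_le: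
  "(\<And>F :: 'u ring. Ring.field F \<Longrightarrow> h F \<le> c) \<Longrightarrow> max_over_fields h \<le> ereal (real_of_int c)"
  unfolding max_over_fields_def by (intro SUP_least) auto

theorem proposition3p25:
  fixes K1 K2 :: "(real^4) set" and D1 D2 :: "(real^2) knot_diagram"
    and s1 s2 :: "'u ring \<Rightarrow> int"
  assumes "smooth_knot K1" and "smooth_knot K2"
    and "diagram_of K1 D1" and "diagram_of K2 D2"
    and "\<And>F. Ring.field F \<Longrightarrow> rasmussen_invariant F D1 (s1 F)"
    and "\<And>F. Ring.field F \<Longrightarrow> rasmussen_invariant F D2 (s2 F)"
  shows "(\<forall>F. Ring.field F \<longrightarrow>
            ereal (real_of_int \<bar>s1 F - s2 F\<bar>) \<le> 2 * ereal_of_enat (lam0 F D1 D2)) \<and>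
         max 0 (max_over_fields (\<lambda>F. s1 F - s2 F)) + max 0 (max_over_fields (\<lambda>F. s2 F - s1 F))
            \<le> 2 * ereal_of_enat (lam0 \<Z> D1 D2) \<and>
         max_over_fields (\<lambda>F. s1 F - s2 F) + max_over_fields (\<lambda>F. s2 F - s1 F)
            \<le> 2 * ereal_of_enat (lam \<Z> D1 D2)"
proof (intro conjI allI impI)
  let ?M12 = "max_over_fields (\<lambda>F. s1 F - s2 F)" and ?M21 = "max_over_fields (\<lambda>F. s2 F - s1 F)"
  \<comment> \<open>The bounds use \<open>i \<le> n\<close> and \<open>j \<le> n\<close>. Adding the
    two equations gives \<open>a + b\<close>, a relation that no longer mentions
    \<open>F\<close>.\<close>
  have int_bounds: "s2 F - s1 F \<le> a + 2 * int n \<and> s1 F - s2 F \<le> b + 2 * int n \<and> a + b = - 2 * int n"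
    if F: "Ring.field F" and G: "G_inverse_maps \<Z> (CBN \<Z> D1) (CBN \<Z> D2) a b n" for F :: "'u ring" and a b n
  proof -
    obtain i j where "i + j = n" "s2 F - s1 F = a + 2 * int i" "s1 F - s2 F = b + 2 * int j"
      by (rule rasmussen_invariant_field [OF F G_inverse_maps_CBN_int_field [OF F G]
            assms(5) [OF F] assms(6) [OF F]])
    then show ?thesis by linarith
  qed
  have max_bounds: "?M12 \<le> ereal (real_of_int (b + 2 * int n))" "?M21 \<le> ereal (real_of_int (a + 2 * int n))"
    if "G_inverse_maps \<Z> (CBN \<Z> D1) (CBN \<Z> D2) a b n" for a b n
    using max_over_fields_le [of "\<lambda>F. s1 F - s2 F" "b + 2 * int n"]
      max_over_fields_le [of "\<lambda>F. s2 F - s1 F" "a + 2 * int n"] int_bounds [OF _ that]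
    by blast+

  show "ereal (real_of_int \<bar>s1 F - s2 F\<bar>) \<le> 2 * ereal_of_enat (lam0 F D1 D2)"
    if F: "Ring.field F" for F
  proof (cases rule: Inf_enat_cases [of "\<lambda>n. \<exists>a b. a \<le> 0 \<and> b \<le> 0 \<and> G_inverse_maps F (CBN F D1) (CBN F D2) a b n"])
    case 1
    then show ?thesis by (simp add: lam0_def)
  next
    case (2 n)
    then obtain a b where ab: "a \<le> 0" "b \<le> 0" "G_inverse_maps F (CBN F D1) (CBN F D2) a b n" by blast
    obtain i j where "i + j = n" "s2 F - s1 F = a + 2 * int i" "s1 F - s2 F = b + 2 * int j"
      by (rule rasmussen_invariant_field [OF F ab(3) assms(5) [OF F] assms(6) [OF F]])
    \<comment> \<open>Since \<open>a\<close> and \<open>b\<close> are at most 0, the two differences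
      are at most \<open>2 i\<close> and \<open>2 j\<close>.\<close>
    with ab have "\<bar>s1 F - s2 F\<bar> \<le> 2 * int n" by simp
    then have "real_of_int \<bar>s1 F - s2 F\<bar> \<le> 2 * real n" by linarith
    with 2 show ?thesis by (simp add: lam0_def)
  qed

  show "max 0 ?M12 + max 0 ?M21 \<le> 2 * ereal_of_enat (lam0 \<Z> D1 D2)"
  proof (cases rule: Inf_enat_cases [of "\<lambda>n. \<exists>a b. a \<le> 0 \<and> b \<le> 0 \<and> G_inverse_maps \<Z> (CBN \<Z> D1) (CBN \<Z> D2) a b n"])
    case 1
    then show ?thesis by (simp add: lam0_def)
  next
    case (2 n)
    then obtain a b where ab: "a \<le> 0" "b \<le> 0" "G_inverse_maps \<Z> (CBN \<Z> D1) (CBN \<Z> D2) a b n" by blast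
    show ?thesis
    \<comment> \<open>One field is needed to obtain the value of \<open>a + b\<close>. If the type
      \<open>'u\<close> carries none, both suprema are minus infinity and the left side is
      0.\<close>
    proof (cases "\<exists>F :: 'u ring. Ring.field F")
      case True
      then have sum: "a + b = - 2 * int n" using int_bounds [OF _ ab(3)] by blast
      \<comment> \<open>The bounds on the maxima become \<open>- a\<close> and \<open>- b\<close>.
        These are nonnegative, so they also bound the maxima with 0, and their sum is
        \<open>2 n\<close>.\<close>
      then have eqs: "b + 2 * int n = - a" "a + 2 * int n = - b" by auto
      have "max 0 ?M12 \<le> ereal (real_of_int (- a))" "max 0 ?M21 \<le> ereal (real_of_int (- b))"
        using max_bounds [OF ab(3)] ab(1,2) unfolding eqs by auto
      then have "max 0 ?M12 + max 0 ?M21 \<le> ereal (real_of_int (- a)) + ereal (real_of_int (- b))"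
        by (rule add_mono)
      also have "\<dots> = 2 * ereal (real n)"
        using sum by simp
      finally show ?thesis using 2 by (simp add: lam0_def)
    next
      case False
      then show ?thesis using 2 by (simp add: max_over_fields_def lam0_def bot_ereal_def)
    qed
  qed

  show "?M12 + ?M21 \<le> 2 * ereal_of_enat (lam \<Z> D1 D2)"
  proof (cases rule: Inf_enat_cases [of "\<lambda>n. \<exists>a b. G_inverse_maps \<Z> (CBN \<Z> D1) (CBN \<Z> D2) a b n"])
    case 1
    then show ?thesis by (simp add: lam_def)
  next
    case (2 n)
    then obtain a b where ab: "G_inverse_maps \<Z> (CBN \<Z> D1) (CBN \<Z> D2) a b n" by blast
    show ?thesis
    proof (cases "\<exists>F :: 'u ring. Ring.field F")
      case True
      then have sum: "a + b = - 2 * int n" using int_bounds [OF _ ab] by blast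
      \<comment> \<open>Without sign conditions the bounds are added as they stand: the total is
        \<open>4 n + a + b = 2 n\<close>.\<close>
      have "?M12 + ?M21 \<le> ereal (real_of_int (b + 2 * int n)) + ereal (real_of_int (a + 2 * int n))"
        by (intro add_mono max_bounds [OF ab])
      also have "\<dots> = 2 * ereal (real n)"
        using sum by simp
      finally show ?thesis using 2 by (simp add: lam_def)
    next
      case False
      then show ?thesis using 2 by (simp add: max_over_fields_def lam_def bot_ereal_def)
    qed
  qed
qed

end
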